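(* Let $\Omega\subseteq\mathbb{C}$ be a domain and let $$\mathcal{L}(\lambda)=\begin{pmatrix}A(\lambda)&B(\lambda)\\C(\lambda)&D(\lambda)\end{pmatrix},\quad\operatorname{dom}\mathcal{L}(\lambda)=\big(\operatorname{dom}A(\lambda)\cap\operatorname{dom}C(\lambda)\big)\oplus\big(\operatorname{dom}B(\lambda)\cap\operatorname{dom}D(\lambda)\big),\quad\lambda\in\Omega,$$ be a family of operator matrices in $\mathcal{H}=\mathcal{H}_1\oplus\mathcal{H}_2$ with Schur complements $S_1,S_2$. In the following, $\pm$ and $\mp$ are to be read with either the upper signs throughout or the lower signs throughout. (i) Suppose that for all $\lambda\in\rho(D)$ we have $C(\lambda)\subseteq\pm B(\lambda)^*$, $A(\lambda)$ is accretive, $\mp D(\lambda)$ is sectorial with vertex $0$ and $B(\lambda)$ is $D(\lambda)$-bounded, and that $\dim\mathcal{H}_1>1$. If, additionally, $\sigma(D)\subseteq W_\Psi(D)$, then $$\sigma_{\mathrm{ap}}(\mathcal{L})\subseteq\sigma_{\mathrm{ap}}(S_1)\cup W_\Psi(D)\subseteq W_\Psi(S_1)\cup W_\Psi(D)\subseteq W^2_{\Psi,2}(\mathcal{L})\subseteq W^2_\Psi(\mathcal{L}).$$ (ii) Suppose that for all $\lambda\in\rho(A)$ we have $C(\lambda)\subseteq\pm B(\lambda)^*$, $A(\lambda)$ is sectorial with vertex $0$, $\mp D(\lambda)$ is accretive and $C(\lambda)$ is $A(\lambda)$-bounded, and that $\dim\mathcal{H}_2>1$. If, additionally, $\sigma(A)\subseteq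 W_\Psi(A)$, then $$\sigma_{\mathrm{ap}}(\mathcal{L})\subseteq\sigma_{\mathrm{ap}}(S_2)\cup W_\Psi(A)\subseteq W_\Psi(S_2)\cup W_\Psi(A)\subseteq W^2_{\Psi,2}(\mathcal{L})\subseteq W^2_\Psi(\mathcal{L}).$$
   Context: $\mathcal{H}_1,\mathcal{H}_2$ are complex Hilbert spaces. Each $\mathcal{L}(\lambda)$ is densely defined, and $A(\lambda)$ in $\mathcal{H}_1$, $B(\lambda)$ from $\mathcal{H}_2$ to $\mathcal{H}_1$, $C(\lambda)$ from $\mathcal{H}_1$ to $\mathcal{H}_2$, $D(\lambda)$ in $\mathcal{H}_2$ are densely defined closable linear operators. Write $\mathcal{D}_1(\lambda)=\operatorname{dom}A(\lambda)\cap\operatorname{dom}C(\lambda)$, $\mathcal{D}_2(\lambda)=\operatorname{dom}B(\lambda)\cap\operatorname{dom}D(\lambda)$. An operator $T$ is accretive if $\operatorname{Re}(Tf,f)\ge0$ for all $f\in\operatorname{dom}T$; it is sectorial with vertex $0$ if there is $\omega\in[0,\pi/2)$ with $(Tf,f)\in\{z:|\arg z|\le\omega\}$ for all $f\in\operatorname{dom}T$ (with $\arg0=0$). $S$ is $T$-bounded if $\operatorname{dom}T\subseteq\operatorname{dom}S$ and there are $a,b\ge0$ with $\|Sx\|\le a\|x\|+b\|Tx\|$, $x\in\operatorname{dom}T$. For an operator family $T(\lambda)$, $\lambda\in\Omega'$, on a set $\Omega'\subseteq\mathbb{C}$: $\sigma(T)=\{\lambda\in\Omega':0\in\sigma(T(\lambda))\}$,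 $\rho(T)=\Omega'\setminus\sigma(T)$, $\sigma_{\mathrm{ap}}(T)=\{\lambda\in\Omega':\exists(f_n)_n\subseteq\operatorname{dom}T(\lambda),\|f_n\|=1,T(\lambda)f_n\to0\}$, $W(T)=\{\lambda\in\Omega':\exists f\in\operatorname{dom}T(\lambda),f\ne0,(T(\lambda)f,f)=0\}$, and the pseudo numerical range is $W_\Psi(T)=\bigcap_{\varepsilon>0}\bigcup_{B\ \text{bounded},\|B\|<\varepsilon}W(T+B)$. Schur complements: $S_1(\lambda)=A(\lambda)-B(\lambda)D(\lambda)^{-1}C(\lambda)$, $\operatorname{dom}S_1(\lambda)=\{f\in\mathcal{D}_1(\lambda):D(\lambda)^{-1}C(\lambda)f\in\operatorname{dom}B(\lambda)\}$, for $\lambda\in\rho(D)$ (family on $\rho(D)$); $S_2(\lambda)=D(\lambda)-C(\lambda)A(\lambda)^{-1}B(\lambda)$, $\operatorname{dom}S_2(\lambda)=\{f\in\mathcal{D}_2(\lambda):A(\lambda)^{-1}B(\lambda)f\in\operatorname{dom}C(\lambda)\}$, for $\lambda\in\rho(A)$ (family on $\rho(A)$). Quadratic numerical range: $W^2(\mathcal{L})$ is the set of $\lambda\in\Omega$ for which there are unit vectors $f\in\mathcal{D}_1(\lambda)$, $g\in\mathcal{D}_2(\lambda)$ with $\det\begin{pmatrix}(A(\lambda)f,f)&(B(\lambda)g,f)\\(C(\lambda)f,g)&(D(\lambda)g,g)\end{pmatrix}=0$. Pseudo quadratic numerical range: $W^2_\Psi(\mathcal{L})=\bigcap_{\varepsilon>0}\bigcup_{\mathcal{B}\in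 L(\mathcal{H}),\|\mathcal{B}\|<\varepsilon}W^2(\mathcal{L}+\mathcal{B})$, where $L(\mathcal{H})$ denotes the bounded linear operators on $\mathcal{H}$. Further, $W^2_{\Psi,2}(\mathcal{L})=\bigcap_{\varepsilon>0}\bigcup_{B_i\in L(\mathcal{H}_i),\|B_i\|<\varepsilon}W^2(\mathcal{L}+\operatorname{diag}(B_1,B_2))$.
   Formalization: The third inclusion fails as stated; it is proved assuming dom B(λ)∩dom D(λ) is a core of D(λ) for λ∈σ(D) in (i), and dom A(λ)∩dom C(λ) is a core of A(λ) for λ∈σ(A) in (ii). H₁ and H₂ are assumed nonzero. *)

theory Defs
  imports "HOL-Analysis.Analysis"
begin

section \<open>Complex Hilbert spaces\<close>

text \<open>The inner product is linear in the first argument. The zero space is an instance of the class.\<close>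

class complex_hilbert = banach +
  fixes scaleC :: "complex \<Rightarrow> 'a \<Rightarrow> 'a" (infixr "*\<^sub>C" 75)
    and cinner :: "'a \<Rightarrow> 'a \<Rightarrow> complex"
  assumes scaleC_add_right: "c *\<^sub>C (x + y) = c *\<^sub>C x + c *\<^sub>C y"
    and scaleC_add_left: "(c + d) *\<^sub>C x = c *\<^sub>C x + d *\<^sub>C x"
    and scaleC_scaleC: "c *\<^sub>C (d *\<^sub>C x) = (c * d) *\<^sub>C x"
    and scaleC_one: "1 *\<^sub>C x = x"
    and scaleR_scaleC: "r *\<^sub>R x = complex_of_real r *\<^sub>C x"
    and cinner_add_left: "cinner (x + y) z = cinner x z + cinner y z"
    and cinner_scaleC_left: "cinner (c *\<^sub>C x) y = c * cinner x y"
    and cinner_commute: "cinner x y = cnj (cinner y x)"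
    and cinner_self: "cinner x x = complex_of_real ((norm x)\<^sup>2)"

global_interpretation complex_vector:
  vector_space "scaleC :: complex \<Rightarrow> 'a::complex_hilbert \<Rightarrow> 'a"
  by unfold_locales (simp_all add: scaleC_add_right scaleC_add_left scaleC_scaleC scaleC_one)

instantiation complex :: complex_hilbert
begin

definition scaleC_complex :: "complex \<Rightarrow> complex \<Rightarrow> complex"
  where "scaleC_complex c x = c * x"

definition cinner_complex :: "complex \<Rightarrow> complex \<Rightarrow> complex"
  where "cinner_complex x y = x * cnj y"

instance
proof
  show "cinner x x = complex_of_real ((norm x)\<^sup>2)" for x :: complex
    by (metis cinner_complex_def complex_norm_square)
qed (simp_all add: scaleC_complex_def cinner_complex_def algebra_simps scaleR_conv_of_real)

end

text \<open>The orthogonal sum; its norm is the one that the library puts on products.\<close>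

instantiation prod :: (complex_hilbert, complex_hilbert) complex_hilbert
begin

definition scaleC_prod :: "complex \<Rightarrow> 'a \<times> 'b \<Rightarrow> 'a \<times> 'b"
  where "scaleC_prod c x = (c *\<^sub>C fst x, c *\<^sub>C snd x)"

definition cinner_prod :: "'a \<times> 'b \<Rightarrow> 'a \<times> 'b \<Rightarrow> complex"
  where "cinner_prod x y = cinner (fst x) (fst y) + cinner (snd x) (snd y)"

instance
proof
  fix x y :: "'a \<times> 'b"
  show "cinner x y = cnj (cinner y x)"
    unfolding cinner_prod_def complex_cnj_add
    by (simp add: cinner_commute[of "fst x"] cinner_commute[of "snd x"])
qed (auto simp: scaleC_prod_def cinner_prod_def scaleC_add_right scaleC_add_left scaleC_scaleC
    scaleC_one scaleR_scaleC cinner_add_left cinner_scaleC_left cinner_self norm_prod_def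
    algebra_simps prod_eq_iff)

end

section \<open>Operators with a domain\<close>

text \<open>The values of \<open>opapp T\<close> outside \<open>opdom T\<close> carry no meaning, and no notion below depends on
  them.\<close>

datatype ('a, 'b) operator = Operator (opdom: "'a set") (opapp: "'a \<Rightarrow> 'b")

definition linear_op :: "('a::complex_hilbert, 'b::complex_hilbert) operator \<Rightarrow> bool"
  where "linear_op T \<longleftrightarrow> complex_vector.subspace (opdom T) \<and>
    (\<forall>x\<in>opdom T. \<forall>y\<in>opdom T. opapp T (x + y) = opapp T x + opapp T y) \<and>
    (\<forall>c. \<forall>x\<in>opdom T. opapp T (c *\<^sub>C x) = c *\<^sub>C opapp T x)"

definition densely_defined :: "('a::complex_hilbert, 'b::complex_hilbert) operator \<Rightarrow> bool"
  where "densely_defined T \<longleftrightarrow> closure (opdom T) = UNIV"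

definition op_graph :: "('a, 'b) operator \<Rightarrow> ('a \<times> 'b) set"
  where "op_graph T = (\<lambda>x. (x, opapp T x)) ` opdom T"

definition closable_op :: "('a::complex_hilbert, 'b::complex_hilbert) operator \<Rightarrow> bool"
  where "closable_op T \<longleftrightarrow> single_valued (closure (op_graph T))"

definition op_restrict :: "('a, 'b) operator \<Rightarrow> 'a set \<Rightarrow> ('a, 'b) operator"
  where "op_restrict T U = Operator (opdom T \<inter> U) (opapp T)"

text \<open>A core is needed at points of the spectrum of \<open>D\<close>, where \<open>B\<close> need not be \<open>D\<close>-bounded:
  elements of \<open>dom D\<close> outside \<open>dom B\<close> count for the pseudo numerical range of \<open>D\<close>, but not for the
  quadratic numerical range. On finitely supported sequences let \<open>D x = (k x_k)_k - \<phi>(x) e_1\<close> with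
  \<open>\<phi>(x) = \<Sum>k\<ge>1. x_k\<close>; let \<open>B = 0\<close> on the kernel of \<open>\<phi>\<close>, \<open>C = 0\<close> and \<open>A = 1\<close> on a space of
  dimension 2. Then \<open>D e_1 = 0\<close>, but \<open>(D x, x) \<ge> (x, x)\<close> on the kernel of \<open>\<phi>\<close>, which is dense.
  For these constant families the pseudo numerical range of \<open>D\<close> is \<open>\<Omega>\<close> and the pseudo
  quadratic numerical range for diagonal perturbations is empty. The same holds for \<open>A\<close> and \<open>C\<close>.\<close>

definition is_core :: "'a set \<Rightarrow> ('a::complex_hilbert, 'b::complex_hilbert) operator \<Rightarrow> bool"
  where "is_core U T \<longleftrightarrow> U \<subseteq> opdom T \<and> op_graph T \<subseteq> closure (op_graph (op_restrict T U))"

definition op_extends :: "('a, 'b) operator \<Rightarrow> ('a, 'b) operator \<Rightarrow> bool" (infix "\<subseteq>\<^sub>o" 50)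
  where "S \<subseteq>\<^sub>o T \<longleftrightarrow> opdom S \<subseteq> opdom T \<and> (\<forall>x\<in>opdom S. opapp S x = opapp T x)"

definition op_scale :: "complex \<Rightarrow> ('a, 'b::complex_hilbert) operator \<Rightarrow> ('a, 'b) operator"
  where "op_scale c T = Operator (opdom T) (\<lambda>x. c *\<^sub>C opapp T x)"

definition op_plus :: "('a, 'b::complex_hilbert) operator \<Rightarrow> ('a \<Rightarrow> 'b) \<Rightarrow> ('a, 'b) operator"
  where "op_plus T B = Operator (opdom T) (\<lambda>x. opapp T x + B x)"

definition op_inverse :: "('a, 'b) operator \<Rightarrow> ('b, 'a) operator"
  where "op_inverse T = Operator (opapp T ` opdom T) (inv_into (opdom T) (opapp T))"

text \<open>The vector selected by \<open>THE\<close> is unique if \<open>T\<close> is densely defined.\<close>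

definition op_adjoint ::
  "('a::complex_hilbert, 'b::complex_hilbert) operator \<Rightarrow> ('b, 'a) operator"
  where "op_adjoint T = Operator
    {g. \<exists>h. \<forall>f\<in>opdom T. cinner (opapp T f) g = cinner f h}
    (\<lambda>g. THE h. \<forall>f\<in>opdom T. cinner (opapp T f) g = cinner f h)"

definition accretive :: "('a::complex_hilbert, 'a) operator \<Rightarrow> bool"
  where "accretive T \<longleftrightarrow> (\<forall>f\<in>opdom T. Re (cinner (opapp T f) f) \<ge> 0)"

text \<open>Sectorial with vertex 0; the library has \<open>Arg 0 = 0\<close>.\<close>

definition sectorial :: "('a::complex_hilbert, 'a) operator \<Rightarrow> bool"
  where "sectorial T \<longleftrightarrow>
    (\<exists>\<omega>. 0 \<le> \<omega> \<and> \<omega> < pi / 2 \<and> (\<forall>f\<in>opdom T. \<bar>Arg (cinner (opapp T f) f)\<bar> \<le> \<omega>))"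

definition relatively_bounded ::
  "('a::complex_hilbert, 'b::complex_hilbert) operator \<Rightarrow>
   ('a, 'c::complex_hilbert) operator \<Rightarrow> bool"
  where "relatively_bounded S T \<longleftrightarrow> opdom T \<subseteq> opdom S \<and>
    (\<exists>a\<ge>0. \<exists>b\<ge>0. \<forall>x\<in>opdom T. norm (opapp S x) \<le> a * norm x + b * norm (opapp T x))"

text \<open>Everywhere defined bounded operators are functions; their operator norm is \<open>onorm\<close>.\<close>

definition bounded_clinear :: "('a::complex_hilbert \<Rightarrow> 'b::complex_hilbert) \<Rightarrow> bool"
  where "bounded_clinear B \<longleftrightarrow> bounded_linear B \<and> (\<forall>c x. B (c *\<^sub>C x) = c *\<^sub>C B x)"

definition op_resolvent_set :: "('a::complex_hilbert, 'a) operator \<Rightarrow> complex set"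
  where "op_resolvent_set T = {z.
    let R = op_plus T (\<lambda>x. - (z *\<^sub>C x)) in
      bij_betw (opapp R) (opdom R) UNIV \<and> bounded_clinear (opapp (op_inverse R))}"

definition op_spectrum :: "('a::complex_hilbert, 'a) operator \<Rightarrow> complex set"
  where "op_spectrum T = - op_resolvent_set T"

section \<open>Operator families\<close>

text \<open>A family is a function on \<open>complex\<close> together with its index set \<open>\<Omega>\<close>.\<close>

type_synonym ('a, 'b) op_family = "complex \<Rightarrow> ('a, 'b) operator"

definition fam_spectrum :: "complex set \<Rightarrow> ('a::complex_hilbert, 'a) op_family \<Rightarrow> complex set"
  where "fam_spectrum \<Omega> T = {z \<in> \<Omega>. 0 \<in> op_spectrum (T z)}"

definition fam_resolvent_set ::
  "complex set \<Rightarrow> ('a::complex_hilbert, 'a) op_family \<Rightarrow> complex set"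
  where "fam_resolvent_set \<Omega> T = \<Omega> - fam_spectrum \<Omega> T"

definition fam_ap_spectrum ::
  "complex set \<Rightarrow> ('a::complex_hilbert, 'a) op_family \<Rightarrow> complex set"
  where "fam_ap_spectrum \<Omega> T = {z \<in> \<Omega>. \<exists>f :: nat \<Rightarrow> 'a.
    (\<forall>n. f n \<in> opdom (T z) \<and> norm (f n) = 1) \<and> (\<lambda>n. opapp (T z) (f n)) \<longlonglongrightarrow> 0}"

definition num_range :: "complex set \<Rightarrow> ('a::complex_hilbert, 'a) op_family \<Rightarrow> complex set"
  where "num_range \<Omega> T =
    {z \<in> \<Omega>. \<exists>f\<in>opdom (T z). f \<noteq> 0 \<and> cinner (opapp (T z) f) f = 0}"

definition pseudo_num_range ::
  "complex set \<Rightarrow> ('a::complex_hilbert, 'a) op_family \<Rightarrow> complex set"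
  where "pseudo_num_range \<Omega> T =
    (\<Inter>\<epsilon>\<in>{0::real<..}. \<Union>B\<in>{B. bounded_clinear B \<and> onorm B < \<epsilon>}.
      num_range \<Omega> (\<lambda>z. op_plus (T z) B))"

section \<open>Operator matrices\<close>

datatype ('a, 'b) op_matrix = Op_Matrix
  (entry11: "('a, 'a) operator") (entry12: "('b, 'a) operator")
  (entry21: "('a, 'b) operator") (entry22: "('b, 'b) operator")

definition dom1 :: "('a, 'b) op_matrix \<Rightarrow> 'a set"
  where "dom1 M = opdom (entry11 M) \<inter> opdom (entry21 M)"

definition dom2 :: "('a, 'b) op_matrix \<Rightarrow> 'b set"
  where "dom2 M = opdom (entry12 M) \<inter> opdom (entry22 M)"

definition matrix_op ::
  "('a::complex_hilbert, 'b::complex_hilbert) op_matrix \<Rightarrow> ('a \<times> 'b, 'a \<times> 'b) operator"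
  where "matrix_op M = Operator (dom1 M \<times> dom2 M)
    (\<lambda>(f, g). (opapp (entry11 M) f + opapp (entry12 M) g,
               opapp (entry21 M) f + opapp (entry22 M) g))"

text \<open>The sum with a bounded operator on the whole space, which is decomposed into its four
  entries.\<close>

definition matrix_plus ::
  "('a::complex_hilbert, 'b::complex_hilbert) op_matrix \<Rightarrow> ('a \<times> 'b \<Rightarrow> 'a \<times> 'b) \<Rightarrow>
   ('a, 'b) op_matrix"
  where "matrix_plus M B = Op_Matrix
    (op_plus (entry11 M) (\<lambda>f. fst (B (f, 0)))) (op_plus (entry12 M) (\<lambda>g. fst (B (0, g))))
    (op_plus (entry21 M) (\<lambda>f. snd (B (f, 0)))) (op_plus (entry22 M) (\<lambda>g. snd (B (0, g))))"

definition bdiag :: "('a \<Rightarrow> 'a) \<Rightarrow> ('b \<Rightarrow> 'b) \<Rightarrow> 'a \<times> 'b \<Rightarrow> 'a \<times> 'b"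
  where "bdiag B1 B2 = (\<lambda>(f, g). (B1 f, B2 g))"

definition schur1 ::
  "('a::complex_hilbert, 'b::complex_hilbert) op_matrix \<Rightarrow> ('a, 'a) operator"
  where "schur1 M =
    (let A = entry11 M; B = entry12 M; C = entry21 M; D' = op_inverse (entry22 M) in
      Operator {f \<in> dom1 M. opapp C f \<in> opdom D' \<and> opapp D' (opapp C f) \<in> opdom B}
        (\<lambda>f. opapp A f - opapp B (opapp D' (opapp C f))))"

definition schur2 ::
  "('a::complex_hilbert, 'b::complex_hilbert) op_matrix \<Rightarrow> ('b, 'b) operator"
  where "schur2 M =
    (let A' = op_inverse (entry11 M); B = entry12 M; C = entry21 M; D = entry22 M in
      Operator {g \<in> dom2 M. opapp B g \<in> opdom A' \<and> opapp A' (opapp B g) \<in> opdom C}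
        (\<lambda>g. opapp D g - opapp C (opapp A' (opapp B g))))"

type_synonym ('a, 'b) op_matrix_family = "complex \<Rightarrow> ('a, 'b) op_matrix"

definition quad_num_range ::
  "complex set \<Rightarrow> ('a::complex_hilbert, 'b::complex_hilbert) op_matrix_family \<Rightarrow> complex set"
  where "quad_num_range \<Omega> L = {z \<in> \<Omega>.
    \<exists>f\<in>dom1 (L z). \<exists>g\<in>dom2 (L z). norm f = 1 \<and> norm g = 1 \<and>
      cinner (opapp (entry11 (L z)) f) f * cinner (opapp (entry22 (L z)) g) g
      - cinner (opapp (entry12 (L z)) g) f * cinner (opapp (entry21 (L z)) f) g = 0}"

definition pseudo_quad_num_range ::
  "complex set \<Rightarrow> ('a::complex_hilbert, 'b::complex_hilbert) op_matrix_family \<Rightarrow> complex set"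
  where "pseudo_quad_num_range \<Omega> L =
    (\<Inter>\<epsilon>\<in>{0::real<..}. \<Union>B\<in>{B :: 'a \<times> 'b \<Rightarrow> 'a \<times> 'b. bounded_clinear B \<and> onorm B < \<epsilon>}.
      quad_num_range \<Omega> (\<lambda>z. matrix_plus (L z) B))"

definition pseudo_quad_num_range_diag ::
  "complex set \<Rightarrow> ('a::complex_hilbert, 'b::complex_hilbert) op_matrix_family \<Rightarrow> complex set"
  where "pseudo_quad_num_range_diag \<Omega> L =
    (\<Inter>\<epsilon>\<in>{0::real<..}.
      \<Union>B1\<in>{B1 :: 'a \<Rightarrow> 'a. bounded_clinear B1 \<and> onorm B1 < \<epsilon>}.
      \<Union>B2\<in>{B2 :: 'b \<Rightarrow> 'b. bounded_clinear B2 \<and> onorm B2 < \<epsilon>}.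
        quad_num_range \<Omega> (\<lambda>z. matrix_plus (L z) (bdiag B1 B2)))"

text \<open>\<open>complex_vector.dim\<close> is 0 on infinite-dimensional spaces, hence not usable here.\<close>

definition cdim_gt_1 :: "'a::complex_hilbert itself \<Rightarrow> bool"
  where "cdim_gt_1 _ \<longleftrightarrow>
    (\<exists>S :: 'a set. finite S \<and> card S > 1 \<and> complex_vector.independent S)"

end

theory Submission
  imports Defs
begin

text \<open>A point \<open>z\<close> lies in the pseudo numerical range of \<open>T\<close> iff \<open>(T f, f)\<close> is arbitrarily small
  relative to \<open>(f, f)\<close>, since the perturbation may be taken as a small multiple of the identity.
  If \<open>(f, g)\<close> is an approximate null vector of the operator matrix, then the sign conditions force
  \<open>(D g, g)\<close> to be small; outside the pseudo numerical range of \<open>D\<close> this makes \<open>g\<close> small, and \<open>f\<close>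
  is an approximate null vector of the Schur complement. Conversely, if \<open>((S + \<alpha>) f, f) = 0\<close>, then
  \<open>f\<close> and \<open>D\<^sup>-\<^sup>1 C f\<close> annihilate the determinant after \<open>A\<close> is shifted by \<open>\<alpha>\<close>; if
  \<open>((D + \<beta>) g, g) = 0\<close>, then \<open>g\<close> and any \<open>f\<close> orthogonal to \<open>B g\<close> do, and such an \<open>f\<close> exists in a dense
  subspace of a space of dimension at least 2. Part (ii) is part (i) for the matrix with the two
  components exchanged.\<close>

section \<open>Hilbert space basics\<close>

lemma norm_scaleC: "norm (c *\<^sub>C x) = cmod c * norm (x::'a::complex_hilbert)"
proof -
  have "complex_of_real ((norm (c *\<^sub>C x))\<^sup>2) = c * cnj c * cinner x x"
    unfolding cinner_self[symmetric] cinner_scaleC_left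
    by (subst cinner_commute) (simp add: cinner_scaleC_left cinner_commute[of x x, symmetric])
  also have "\<dots> = complex_of_real ((cmod c * norm x)\<^sup>2)"
    by (simp add: cinner_self power_mult_distrib flip: complex_norm_square)
  finally have "(norm (c *\<^sub>C x))\<^sup>2 = (cmod c * norm x)\<^sup>2"
    by (simp only: of_real_eq_iff)
  then show ?thesis by (simp add: power2_eq_iff_nonneg)
qed

lemma cinner_scaleC_right: "cinner x (c *\<^sub>C y) = cnj c * cinner x (y::'a::complex_hilbert)"
  by (metis cinner_commute cinner_scaleC_left complex_cnj_mult)

lemma cinner_add_right: "cinner x (y + z) = cinner x y + cinner x (z::'a::complex_hilbert)"
  by (metis cinner_add_left cinner_commute complex_cnj_add)

lemma cinner_diff_left: "cinner (x - y) z = cinner x z - cinner (y::'a::complex_hilbert) z"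
  by (metis add_diff_cancel_right' cinner_add_left diff_add_cancel)

lemma cinner_diff_right: "cinner x (y - z) = cinner x y - cinner x (z::'a::complex_hilbert)"
  by (metis add_diff_cancel_right' cinner_add_right diff_add_cancel)

lemma cinner_Cauchy_Schwarz: "cmod (cinner x y) \<le> norm x * norm (y::'a::complex_hilbert)"
proof (cases "y = 0")
  case True
  then show ?thesis using cinner_diff_right[of x 0 0] by simp
next
  case False
  define c where "c = cinner x y"
  define n where "n = norm y"
  have n: "n > 0" using False by (simp add: n_def)
  \<comment> \<open>This is |y|^2 times the component of \<open>x\<close> orthogonal to
    \<open>y\<close>, cleared of denominators. That its squared norm is nonnegative is the claimed
    inequality, up to a positive factor.\<close>
  define w where "w = complex_of_real (n\<^sup>2) *\<^sub>C x - c *\<^sub>C y"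
  have yx: "cinner y x = cnj c" by (simp add: c_def cinner_commute[of y x])
  have "complex_of_real ((norm w)\<^sup>2) = cinner w w" by (simp add: cinner_self)
  also have "\<dots> = complex_of_real (n^2 * (n\<^sup>2 * (norm x)\<^sup>2 - (cmod c)\<^sup>2))"
    unfolding w_def cinner_diff_left cinner_diff_right cinner_scaleC_left cinner_scaleC_right yx
      of_real_mult of_real_diff complex_norm_square[of c] cinner_self[of x] cinner_self[of y]
    by (simp add: algebra_simps power2_eq_square flip: c_def n_def)
  finally have "(norm w)\<^sup>2 = n^2 * (n\<^sup>2 * (norm x)\<^sup>2 - (cmod c)\<^sup>2)" by (simp only: of_real_eq_iff)
  then have "n^2 * (n\<^sup>2 * (norm x)\<^sup>2 - (cmod c)\<^sup>2) \<ge> 0" by (metis zero_le_power2)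
  then have "(cmod c)\<^sup>2 \<le> (norm x * n)\<^sup>2"
    using n by (simp add: zero_le_mult_iff power_mult_distrib mult.commute)
  then show ?thesis using n by (simp add: c_def n_def power2_le_iff_abs_le)
qed

text \<open>Real bilinearity is enough here: it supplies the continuity and limit rules for the
  inner product.\<close>

interpretation cinner: bounded_bilinear "cinner :: 'a::complex_hilbert \<Rightarrow> 'a \<Rightarrow> complex"
proof
  show "\<exists>K. \<forall>a b::'a. norm (cinner a b) \<le> norm a * norm b * K"
    by (intro exI[of _ 1]) (simp add: cinner_Cauchy_Schwarz)
qed (simp_all add: cinner_add_left cinner_add_right scaleR_scaleC cinner_scaleC_left
    cinner_scaleC_right scaleC_complex_def)

lemma bounded_clinear_scaleC: "bounded_clinear (\<lambda>x::'a::complex_hilbert. c *\<^sub>C x)"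
  unfolding bounded_clinear_def
proof
  show "bounded_linear (\<lambda>x::'a. c *\<^sub>C x)"
    by (rule bounded_linear_intro[of _ "cmod c"])
      (simp_all add: scaleC_add_right scaleR_scaleC norm_scaleC mult.commute)
qed (simp add: mult.commute)

text \<open>An inequality, because on the zero space the operator norm is 0.\<close>

lemma onorm_scaleC_le: "onorm (\<lambda>x::'a::complex_hilbert. c *\<^sub>C x) \<le> cmod c"
  by (rule onorm_bound) (simp_all add: norm_scaleC)

section \<open>Orthogonality and dense subspaces\<close>

text \<open>The vectors orthogonal to \<open>h\<close> form a closed set; containing
  \<open>U\<close>, it contains \<open>h\<close> itself. This makes the value of the adjoint
  unique.\<close>

lemma eq_zero_if_orthogonal_to_dense:
  fixes h :: "'a::complex_hilbert"
  assumes "closure U = UNIV" and orth: "\<And>g. g \<in> U \<Longrightarrow> cinner g h = 0"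
  shows "h = 0"
proof -
  have "closure U \<subseteq> {g. cinner g h = 0}"
    using orth by (intro closure_minimal closed_Collect_eq)
      (auto intro!: continuous_intros cinner.continuous_on)
  then have "cinner h h = 0" using assms(1) by blast
  then show ?thesis by (simp add: cinner_self)
qed

text \<open>Otherwise the functional (., v) would be injective on \<open>U\<close>, so any two
  elements of \<open>U\<close> would be proportional. Proportionality to a fixed vector is a closed
  condition, so the whole space would be a line.\<close>

lemma ex_orthogonal_in_dense_subspace:
  fixes v :: "'a::complex_hilbert"
  assumes dim: "cdim_gt_1 TYPE('a)" and sub: "complex_vector.subspace U" and dense: "closure U = UNIV"
  obtains f where "f \<in> U" "f \<noteq> 0" "cinner v f = 0"
proof (rule ccontr)
  assume contr: "\<not> thesis"
  have none: "f = 0" if "f \<in> U" "cinner f v = 0" for f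
    using that contr cinner_commute[of v f] \<open>\<And>f. \<lbrakk>f \<in> U; f \<noteq> 0; cinner v f = 0\<rbrakk> \<Longrightarrow> thesis\<close> by auto
  obtain S :: "'a set" where S: "finite S" "card S > 1" "complex_vector.independent S"
    using dim unfolding cdim_gt_1_def by blast
  \<comment> \<open>If \<open>U\<close> were trivial, so would be its closure, and an independent
    set in the span of the empty set has no elements.\<close>
  have "\<exists>e\<in>U. e \<noteq> 0"
  proof (rule ccontr)
    assume "\<not> ?thesis"
    then have "closure U \<subseteq> {0}" by (intro closure_minimal) auto
    then have "S \<subseteq> complex_vector.span {}" using dense by auto
    from complex_vector.independent_span_bound[OF _ S(3) this] S(2) show False by simp
  qed
  then obtain e where e: "e \<in> U" "e \<noteq> 0" by blast
  \<comment> \<open>This combination lies in \<open>U\<close> and is orthogonal to \<open>v\<close>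
    by construction, so \<open>none\<close> applies.\<close>
  have "cinner e v *\<^sub>C f - cinner f v *\<^sub>C e = 0" if "f \<in> U" for f
    using sub e that
    by (intro none complex_vector.subspace_diff complex_vector.subspace_scale)
      (simp_all add: cinner_diff_left cinner_scaleC_left)
  moreover have "continuous_on UNIV (\<lambda>f. cinner e v *\<^sub>C f - cinner f v *\<^sub>C e)"
  proof -
    have "continuous_on UNIV (\<lambda>f. cinner f v *\<^sub>C e)"
    proof -
      have "bounded_linear (\<lambda>f. cinner f v *\<^sub>C e)"
        by (rule bounded_linear_intro[of _ "norm v * norm e"])
          (auto simp: scaleC_add_left cinner_add_left norm_scaleC scaleR_scaleC cinner_scaleC_left
            mult.assoc[symmetric] intro!: mult_right_mono cinner_Cauchy_Schwarz)
      then show ?thesis by (rule linear_continuous_on)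
    qed
    moreover have "continuous_on UNIV (\<lambda>f::'a. cinner e v *\<^sub>C f)"
      using bounded_clinear_scaleC linear_continuous_on unfolding bounded_clinear_def by blast
    ultimately show ?thesis by (intro continuous_on_diff)
  qed
  ultimately have "closure U \<subseteq> {f. cinner e v *\<^sub>C f - cinner f v *\<^sub>C e = 0}"
    by (intro closure_minimal closed_Collect_eq) auto
  then have *: "cinner e v *\<^sub>C f = cinner f v *\<^sub>C e" for f using dense by auto
  have "cinner e v \<noteq> 0" using none e by blast
  then have "f = (cinner f v / cinner e v) *\<^sub>C e" for f
    using arg_cong[OF *[of f], of "\<lambda>x. (1 / cinner e v) *\<^sub>C x"] by (simp add: scaleC_one)
  then have "S \<subseteq> complex_vector.span {e}"
    by (metis complex_vector.span_base complex_vector.span_scale insertI1 subsetI)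
  from complex_vector.independent_span_bound[OF _ S(3) this] S(2) show False by simp
qed

section \<open>Numerical ranges\<close>

text \<open>By Cauchy-Schwarz a perturbation of norm below \<epsilon> contributes less than
  \<epsilon> |f|^2 to the form at a nonzero \<open>f\<close>; conversely, a scalar perturbation
  cancels the form at a single vector. The strict inequality excludes \<open>f = 0\<close>. All
  later arguments about pseudo numerical ranges use this version.\<close>

lemma pseudo_num_range_iff:
  "z \<in> pseudo_num_range \<Omega> T \<longleftrightarrow> z \<in> \<Omega> \<and>
    (\<forall>\<epsilon>>0. \<exists>f\<in>opdom (T z). cmod (cinner (opapp (T z) f) f) < \<epsilon> * (norm f)\<^sup>2)"
proof (intro iffI conjI allI impI)
  assume z: "z \<in> pseudo_num_range \<Omega> T"
  have ex: "\<exists>E f. z \<in> \<Omega> \<and> bounded_clinear E \<and> onorm E < \<epsilon> \<and> f \<in> opdom (T z) \<and> f \<noteq> 0 \<and>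
    cinner (opapp (T z) f + E f) f = 0" if "\<epsilon> > 0" for \<epsilon> :: real
    using z that unfolding pseudo_num_range_def num_range_def op_plus_def by fastforce
  from ex[of 1] show "z \<in> \<Omega>" by auto
  fix \<epsilon> :: real assume "\<epsilon> > 0"
  from ex[OF this] obtain E f where E: "bounded_clinear E" "onorm E < \<epsilon>"
    and f: "f \<in> opdom (T z)" "f \<noteq> 0" and eq: "cinner (opapp (T z) f + E f) f = 0" by blast
  have "cmod (cinner (opapp (T z) f) f) = cmod (cinner (E f) f)"
    using eq by (simp add: cinner_add_left add_eq_0_iff)
  also have "\<dots> \<le> norm (E f) * norm f" by (rule cinner_Cauchy_Schwarz)
  also have "\<dots> \<le> onorm E * norm f * norm f"
    using E by (intro mult_right_mono onorm) (auto simp: bounded_clinear_def)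
  also have "\<dots> < \<epsilon> * norm f * norm f" using E f by simp
  finally show "\<exists>f\<in>opdom (T z). cmod (cinner (opapp (T z) f) f) < \<epsilon> * (norm f)\<^sup>2"
    using f by (auto simp: power2_eq_square mult.assoc)
next
  assume z: "z \<in> \<Omega> \<and>
    (\<forall>\<epsilon>>0. \<exists>f\<in>opdom (T z). cmod (cinner (opapp (T z) f) f) < \<epsilon> * (norm f)\<^sup>2)"
  show "z \<in> pseudo_num_range \<Omega> T"
    unfolding pseudo_num_range_def
  proof (rule INT_I)
    fix \<epsilon> :: real assume "\<epsilon> \<in> {0<..}"
    then obtain f where f: "f \<in> opdom (T z)" "cmod (cinner (opapp (T z) f) f) < \<epsilon> * (norm f)\<^sup>2"
      using z by auto
    then have "f \<noteq> 0" by auto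
    \<comment> \<open>The negative of the form divided by (f, f): the scalar shift that annihilates
      the form at \<open>f\<close>.\<close>
    define \<alpha> where "\<alpha> = - cinner (opapp (T z) f) f / cinner f f"
    have "cmod \<alpha> < \<epsilon>"
      using f \<open>f \<noteq> 0\<close> by (simp add: \<alpha>_def norm_divide cinner_self divide_less_eq norm_power)
    then have "onorm (\<lambda>x::'a. \<alpha> *\<^sub>C x) < \<epsilon>" using onorm_scaleC_le[of \<alpha>] by (rule order_le_less_trans[rotated])
    moreover have "z \<in> num_range \<Omega> (\<lambda>z. op_plus (T z) (\<lambda>x. \<alpha> *\<^sub>C x))"
    proof -
      have "cinner (opapp (T z) f + \<alpha> *\<^sub>C f) f = 0"
        using \<open>f \<noteq> 0\<close> unfolding cinner_add_left cinner_scaleC_left \<alpha>_def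
        by (simp add: cinner_self)
      then show ?thesis
        using f \<open>f \<noteq> 0\<close> z unfolding num_range_def op_plus_def by auto
    qed
    ultimately show "z \<in> (\<Union>B\<in>{B. bounded_clinear B \<and> onorm B < \<epsilon>}.
      num_range \<Omega> (\<lambda>z. op_plus (T z) B))"
      using bounded_clinear_scaleC by blast
  qed
qed

text \<open>The condition is homogeneous in \<open>f\<close>, so by linearity the vectors found for
  \<epsilon> = 1/(n+1) can be scaled to norm 1 and form the required sequence.\<close>

lemma fam_ap_spectrum_iff:
  assumes lin: "linear_op (T z)"
  shows "z \<in> fam_ap_spectrum \<Omega> T \<longleftrightarrow> z \<in> \<Omega> \<and>
    (\<forall>\<epsilon>>0. \<exists>f\<in>opdom (T z). norm (opapp (T z) f) < \<epsilon> * norm f)"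
proof (intro iffI conjI allI impI)
  assume "z \<in> fam_ap_spectrum \<Omega> T"
  then obtain f where z: "z \<in> \<Omega>" and f: "\<And>n::nat. f n \<in> opdom (T z)" "\<And>n. norm (f n) = 1"
    and lim: "(\<lambda>n. opapp (T z) (f n)) \<longlonglongrightarrow> 0" unfolding fam_ap_spectrum_def by blast
  show "z \<in> \<Omega>" by (rule z)
  fix \<epsilon> :: real assume "\<epsilon> > 0"
  from LIMSEQ_D[OF lim this] obtain n where "norm (opapp (T z) (f n)) < \<epsilon>" by auto
  then show "\<exists>f\<in>opdom (T z). norm (opapp (T z) f) < \<epsilon> * norm f"
    using f by (intro bexI[of _ "f n"]) simp_all
next
  assume R: "z \<in> \<Omega> \<and> (\<forall>\<epsilon>>0. \<exists>f\<in>opdom (T z). norm (opapp (T z) f) < \<epsilon> * norm f)"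
  have "\<exists>f\<in>opdom (T z). norm f = 1 \<and> norm (opapp (T z) f) < 1 / Suc n" for n
  proof -
    obtain f where f: "f \<in> opdom (T z)" "norm (opapp (T z) f) < 1 / Suc n * norm f"
      using R by (meson of_nat_0_less_iff zero_less_Suc zero_less_divide_1_iff)
    then have "f \<noteq> 0" by auto
    let ?c = "complex_of_real (1 / norm f)"
    have "?c *\<^sub>C f \<in> opdom (T z)" "opapp (T z) (?c *\<^sub>C f) = ?c *\<^sub>C opapp (T z) f"
      using lin f unfolding linear_op_def by (simp_all add: complex_vector.subspace_scale)
    then show ?thesis
      using f \<open>f \<noteq> 0\<close>
      by (intro bexI[of _ "?c *\<^sub>C f"]) (simp_all add: norm_scaleC norm_divide divide_less_eq)
  qed
  then obtain f where f: "\<And>n. f n \<in> opdom (T z)" "\<And>n. norm (f n) = 1"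
    "\<And>n. norm (opapp (T z) (f n)) < 1 / Suc n" by metis
  have "(\<lambda>n. opapp (T z) (f n)) \<longlonglongrightarrow> 0"
    by (rule Lim_null_comparison[OF _ LIMSEQ_Suc[OF lim_1_over_n]])
      (use f in \<open>auto intro!: always_eventually less_imp_le simp: add.commute\<close>)
  then show "z \<in> fam_ap_spectrum \<Omega> T" using R f unfolding fam_ap_spectrum_def by blast
qed

text \<open>For unit vectors Cauchy-Schwarz bounds the form at \<open>f n\<close> by the norm of its
  image.\<close>

lemma fam_ap_spectrum_subset_pseudo_num_range: "fam_ap_spectrum \<Omega> T \<subseteq> pseudo_num_range \<Omega> T"
proof
  fix z assume "z \<in> fam_ap_spectrum \<Omega> T"
  then obtain f where z: "z \<in> \<Omega>" and f: "\<And>n::nat. f n \<in> opdom (T z)" "\<And>n. norm (f n) = 1"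
    and lim: "(\<lambda>n. opapp (T z) (f n)) \<longlonglongrightarrow> 0" unfolding fam_ap_spectrum_def by blast
  have "\<exists>f\<in>opdom (T z). cmod (cinner (opapp (T z) f) f) < \<epsilon> * (norm f)\<^sup>2" if \<epsilon>: "\<epsilon> > 0" for \<epsilon>
  proof -
    obtain n where "norm (opapp (T z) (f n)) < \<epsilon>"
      using LIMSEQ_D[OF lim \<epsilon>] by auto
    then have "cmod (cinner (opapp (T z) (f n)) (f n)) < \<epsilon>"
      using cinner_Cauchy_Schwarz[of "opapp (T z) (f n)" "f n"] f(2)[of n] by simp
    then show ?thesis using f by (intro bexI[of _ "f n"]) simp_all
  qed
  then show "z \<in> pseudo_num_range \<Omega> T" using z by (simp add: pseudo_num_range_iff)
qed

lemma linear_op_zero: "linear_op T \<Longrightarrow> opapp T 0 = 0"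
  unfolding linear_op_def by (metis complex_vector.scale_zero_left complex_vector.subspace_0)

section \<open>Quadratic forms on cores and in sectors\<close>

text \<open>Both sides of the strict inequality are continuous along convergence in the graph, so it
  persists at elements of the core close to \<open>f\<close>. Hence vectors showing that a point is
  in the pseudo numerical range of \<open>D\<close> can be chosen in the domain of \<open>B\<close>
  as well.\<close>

lemma is_core_quadratic_form_small:
  assumes core: "is_core U T" and f: "f \<in> opdom T" "cmod (cinner (opapp T f) f) < \<epsilon> * (norm f)\<^sup>2"
  shows "\<exists>g\<in>U. cmod (cinner (opapp T g) g) < \<epsilon> * (norm g)\<^sup>2"
proof -
  have "(f, opapp T f) \<in> closure (op_graph (op_restrict T U))"
    using core f unfolding is_core_def op_graph_def by blast
  then obtain X where X: "\<And>n. X n \<in> op_graph (op_restrict T U)" "X \<longlonglongrightarrow> (f, opapp T f)"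
    unfolding closure_sequential by blast
  define x where "x n = fst (X n)" for n
  have x: "x n \<in> U" "X n = (x n, opapp T (x n))" for n
    using X(1)[of n] by (auto simp: x_def op_graph_def op_restrict_def)
  have lim: "x \<longlonglongrightarrow> f" "(\<lambda>n. opapp T (x n)) \<longlonglongrightarrow> opapp T f"
    using tendsto_fst[OF X(2)] tendsto_snd[OF X(2)] by (simp_all add: x)
  have "(\<lambda>n. \<epsilon> * (norm (x n))\<^sup>2 - cmod (cinner (opapp T (x n)) (x n))) \<longlonglongrightarrow>
      \<epsilon> * (norm f)\<^sup>2 - cmod (cinner (opapp T f) f)"
    by (intro tendsto_intros cinner.tendsto lim)
  then have "\<forall>\<^sub>F n in sequentially. 0 < \<epsilon> * (norm (x n))\<^sup>2 - cmod (cinner (opapp T (x n)) (x n))"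
    using f(2) by (intro order_tendstoD(1)) auto
  then obtain n where "0 < \<epsilon> * (norm (x n))\<^sup>2 - cmod (cinner (opapp T (x n)) (x n))"
    using eventually_happens' sequentially_bot by blast
  then show ?thesis using x by (intro bexI[of _ "x n"]) auto
qed

text \<open>The constant is cos \<omega>, positive because \<omega> < pi/2: the real part of w is
  |w| cos(arg w), and cosine decreases on [0, pi].\<close>

lemma sectorial_cmod_le_Re:
  assumes "sectorial T"
  obtains c where "c > 0" "\<And>f. f \<in> opdom T \<Longrightarrow> c * cmod (cinner (opapp T f) f) \<le> Re (cinner (opapp T f) f)"
proof -
  obtain \<omega> where \<omega>: "0 \<le> \<omega>" "\<omega> < pi / 2" "\<And>f. f \<in> opdom T \<Longrightarrow> \<bar>Arg (cinner (opapp T f) f)\<bar> \<le> \<omega>"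
    using assms unfolding sectorial_def by blast
  have "cos \<omega> * cmod w \<le> Re w" if "\<bar>Arg w\<bar> \<le> \<omega>" for w
  proof -
    have "cos \<omega> \<le> cos \<bar>Arg w\<bar>" using \<omega> that by (intro cos_monotone_0_pi_le) auto
    then have "cos \<omega> * cmod w \<le> cos (Arg w) * cmod w" by (intro mult_right_mono) auto
    also have "\<dots> = Re (rcis (cmod w) (Arg w))" by simp
    finally show ?thesis by (simp only: rcis_cmod_Arg)
  qed
  moreover have "cos \<omega> > 0" using \<omega> by (intro cos_gt_zero_pi) auto
  ultimately show ?thesis using that \<omega>(3) by blast
qed

section \<open>Operator matrices\<close>

text \<open>Scalar perturbations of the two diagonal entries suffice. The equation is homogeneous in
  \<open>f\<close> and in \<open>g\<close>, so unit vectors need not be supplied.\<close>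

lemma pseudo_quad_num_range_diagI:
  assumes z: "z \<in> \<Omega>"
    and lin: "linear_op (entry11 (L z))" "linear_op (entry12 (L z))" "linear_op (entry21 (L z))"
      "linear_op (entry22 (L z))"
    and ex: "\<And>\<epsilon>. \<epsilon> > 0 \<Longrightarrow> \<exists>f\<in>dom1 (L z). \<exists>g\<in>dom2 (L z). \<exists>\<alpha> \<beta>.
      f \<noteq> 0 \<and> g \<noteq> 0 \<and> cmod \<alpha> < \<epsilon> \<and> cmod \<beta> < \<epsilon> \<and>
      (cinner (opapp (entry11 (L z)) f) f + \<alpha> * cinner f f) *
        (cinner (opapp (entry22 (L z)) g) g + \<beta> * cinner g g) =
      cinner (opapp (entry12 (L z)) g) f * cinner (opapp (entry21 (L z)) f) g"
  shows "z \<in> pseudo_quad_num_range_diag \<Omega> L"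
  unfolding pseudo_quad_num_range_diag_def
proof (rule INT_I)
  fix \<epsilon> :: real assume "\<epsilon> \<in> {0<..}"
  then obtain f g \<alpha> \<beta> where fg: "f \<in> dom1 (L z)" "g \<in> dom2 (L z)" "f \<noteq> 0" "g \<noteq> 0"
    and small: "cmod \<alpha> < \<epsilon>" "cmod \<beta> < \<epsilon>"
    and eq: "(cinner (opapp (entry11 (L z)) f) f + \<alpha> * cinner f f) *
        (cinner (opapp (entry22 (L z)) g) g + \<beta> * cinner g g) =
      cinner (opapp (entry12 (L z)) g) f * cinner (opapp (entry21 (L z)) f) g"
    using ex[of \<epsilon>] by auto
  define u where "u = complex_of_real (1 / norm f)"
  define v where "v = complex_of_real (1 / norm g)"
  let ?E = "bdiag (\<lambda>x. \<alpha> *\<^sub>C x) (\<lambda>x. \<beta> *\<^sub>C x)"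
  have dom: "u *\<^sub>C f \<in> dom1 (L z)" "v *\<^sub>C g \<in> dom2 (L z)"
    using fg lin unfolding dom1_def dom2_def linear_op_def
    by (auto intro: complex_vector.subspace_scale)
  have app: "opapp (entry11 (L z)) (u *\<^sub>C f) = u *\<^sub>C opapp (entry11 (L z)) f"
    "opapp (entry21 (L z)) (u *\<^sub>C f) = u *\<^sub>C opapp (entry21 (L z)) f"
    "opapp (entry12 (L z)) (v *\<^sub>C g) = v *\<^sub>C opapp (entry12 (L z)) g"
    "opapp (entry22 (L z)) (v *\<^sub>C g) = v *\<^sub>C opapp (entry22 (L z)) g"
    using fg lin unfolding dom1_def dom2_def linear_op_def by auto
  have real: "cnj u = u" "cnj v = v" by (simp_all add: u_def v_def)
  have "z \<in> quad_num_range \<Omega> (\<lambda>z. matrix_plus (L z) ?E)"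
    unfolding quad_num_range_def
  proof (intro CollectI conjI bexI)
    \<comment> \<open>Since \<open>u\<close> and \<open>v\<close> are real, normalising multiplies
      the determinant by u^2 v^2.\<close>
    have "cinner (opapp (entry11 (L z)) (u *\<^sub>C f) + \<alpha> *\<^sub>C u *\<^sub>C f) (u *\<^sub>C f)
        * cinner (opapp (entry22 (L z)) (v *\<^sub>C g) + \<beta> *\<^sub>C v *\<^sub>C g) (v *\<^sub>C g) -
        cinner (opapp (entry12 (L z)) (v *\<^sub>C g)) (u *\<^sub>C f)
        * cinner (opapp (entry21 (L z)) (u *\<^sub>C f)) (v *\<^sub>C g) =
      (u * u) * (v * v) * ((cinner (opapp (entry11 (L z)) f) f + \<alpha> * cinner f f) *
        (cinner (opapp (entry22 (L z)) g) g + \<beta> * cinner g g) -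
        cinner (opapp (entry12 (L z)) g) f * cinner (opapp (entry21 (L z)) f) g)"
      unfolding app by (simp add: cinner_add_left cinner_scaleC_left cinner_scaleC_right real algebra_simps)
    then show "cinner (opapp (entry11 (matrix_plus (L z) ?E)) (u *\<^sub>C f)) (u *\<^sub>C f) *
        cinner (opapp (entry22 (matrix_plus (L z) ?E)) (v *\<^sub>C g)) (v *\<^sub>C g) -
        cinner (opapp (entry12 (matrix_plus (L z) ?E)) (v *\<^sub>C g)) (u *\<^sub>C f) *
        cinner (opapp (entry21 (matrix_plus (L z) ?E)) (u *\<^sub>C f)) (v *\<^sub>C g) = 0"
      using eq by (simp add: matrix_plus_def op_plus_def bdiag_def)
    show "norm (u *\<^sub>C f) = 1" "norm (v *\<^sub>C g) = 1"
      using fg by (simp_all add: u_def v_def norm_scaleC norm_divide)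
    show "u *\<^sub>C f \<in> dom1 (matrix_plus (L z) ?E)" "v *\<^sub>C g \<in> dom2 (matrix_plus (L z) ?E)"
      using dom by (simp_all add: dom1_def dom2_def matrix_plus_def op_plus_def)
  qed (rule z)
  moreover have "onorm (\<lambda>x::'a. \<alpha> *\<^sub>C x) < \<epsilon>" "onorm (\<lambda>x::'b. \<beta> *\<^sub>C x) < \<epsilon>"
    using small onorm_scaleC_le order_le_less_trans by blast+
  ultimately show "z \<in> (\<Union>B1\<in>{B1 :: 'a \<Rightarrow> 'a. bounded_clinear B1 \<and> onorm B1 < \<epsilon>}.
      \<Union>B2\<in>{B2 :: 'b \<Rightarrow> 'b. bounded_clinear B2 \<and> onorm B2 < \<epsilon>}.
        quad_num_range \<Omega> (\<lambda>z. matrix_plus (L z) (bdiag B1 B2)))"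
    by (intro UN_I[of "\<lambda>x. \<alpha> *\<^sub>C x"] UN_I[of "\<lambda>x. \<beta> *\<^sub>C x"] CollectI conjI bounded_clinear_scaleC)
qed

text \<open>On the orthogonal sum a diagonal operator has norm at most the maximum of the norms of
  its entries, so it is an admissible perturbation for the same \<epsilon>.\<close>

lemma pseudo_quad_num_range_diag_subset:
  fixes L :: "('a::complex_hilbert, 'b::complex_hilbert) op_matrix_family"
  shows "pseudo_quad_num_range_diag \<Omega> L \<subseteq> pseudo_quad_num_range \<Omega> L"
proof
  fix z assume z: "z \<in> pseudo_quad_num_range_diag \<Omega> L"
  show "z \<in> pseudo_quad_num_range \<Omega> L"
    unfolding pseudo_quad_num_range_def
  proof (rule INT_I)
    fix \<epsilon> :: real assume "\<epsilon> \<in> {0<..}"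
    then obtain B1 :: "'a \<Rightarrow> 'a" and B2 :: "'b \<Rightarrow> 'b" where B1: "bounded_clinear B1" "onorm B1 < \<epsilon>"
      and B2: "bounded_clinear B2" "onorm B2 < \<epsilon>"
      and mem: "z \<in> quad_num_range \<Omega> (\<lambda>z. matrix_plus (L z) (bdiag B1 B2))"
      using z unfolding pseudo_quad_num_range_diag_def by blast
    have lin: "bounded_linear B1" "bounded_linear B2"
      using B1 B2 by (simp_all add: bounded_clinear_def)
    have "bounded_linear (bdiag B1 B2)"
      unfolding bdiag_def case_prod_unfold
      by (intro bounded_linear_Pair bounded_linear_compose[OF lin(1)] bounded_linear_fst
          bounded_linear_compose[OF lin(2)] bounded_linear_snd)
    then have "bounded_clinear (bdiag B1 B2)"
      using B1 B2 by (auto simp: bounded_clinear_def bdiag_def scaleC_prod_def)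
    moreover have "onorm (bdiag B1 B2) \<le> max (onorm B1) (onorm B2)" (is "_ \<le> ?m")
    proof (rule onorm_bound)
      show m: "0 \<le> ?m" using onorm_pos_le[OF lin(1)] by simp
      fix x :: "'a \<times> 'b"
      have "norm (B1 (fst x)) \<le> ?m * norm (fst x)" "norm (B2 (snd x)) \<le> ?m * norm (snd x)"
        using onorm[OF lin(1)] onorm[OF lin(2)]
        by (meson max.cobounded1 max.cobounded2 mult_right_mono norm_ge_zero order_trans)+
      then have "(norm (bdiag B1 B2 x))\<^sup>2 \<le> (?m * norm (fst x))\<^sup>2 + (?m * norm (snd x))\<^sup>2"
        by (simp add: bdiag_def case_prod_unfold norm_Pair add_mono power_mono)
      also have "\<dots> = (?m * norm x)\<^sup>2"
        by (simp add: norm_prod_def power_mult_distrib algebra_simps)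
      finally show "norm (bdiag B1 B2 x) \<le> ?m * norm x"
        by (rule power2_le_imp_le) (use m in simp)
    qed
    ultimately show "z \<in> (\<Union>B\<in>{B :: 'a \<times> 'b \<Rightarrow> 'a \<times> 'b. bounded_clinear B \<and> onorm B < \<epsilon>}.
      quad_num_range \<Omega> (\<lambda>z. matrix_plus (L z) B))"
      using mem B1 B2 by force
  qed
qed


section \<open>Bounded inverses and the Schur complement\<close>

text \<open>For the spectral parameter 0 the shifted operator is \<open>T\<close> itself, and
  bijectivity makes \<open>inv_into\<close> a genuine two-sided inverse.\<close>

lemma zero_in_op_resolvent_setD:
  assumes "0 \<in> op_resolvent_set T"
  shows "opdom (op_inverse T) = UNIV"
    and "opapp (op_inverse T) y \<in> opdom T"
    and "opapp T (opapp (op_inverse T) y) = y"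
    and "x \<in> opdom T \<Longrightarrow> opapp (op_inverse T) (opapp T x) = x"
    and "bounded_clinear (opapp (op_inverse T))"
proof -
  have bij: "bij_betw (opapp T) (opdom T) UNIV"
    and bdd: "bounded_clinear (opapp (op_inverse T))"
    using assms unfolding op_resolvent_set_def op_plus_def op_inverse_def by simp_all
  then show "opdom (op_inverse T) = UNIV" "opapp (op_inverse T) y \<in> opdom T"
    "opapp T (opapp (op_inverse T) y) = y"
    "x \<in> opdom T \<Longrightarrow> opapp (op_inverse T) (opapp T x) = x"
    by (auto simp: op_inverse_def bij_betw_def inv_into_into f_inv_into_f)
  show "bounded_clinear (opapp (op_inverse T))" by (rule bdd)
qed

lemma fam_resolvent_set_iff: "z \<in> fam_resolvent_set \<Omega> T \<longleftrightarrow> z \<in> \<Omega> \<and> 0 \<in> op_resolvent_set (T z)"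
  by (auto simp: fam_resolvent_set_def fam_spectrum_def op_spectrum_def)

text \<open>The inverse of \<open>D\<close> is everywhere defined with values in the domain of
  \<open>D\<close>, hence in that of \<open>B\<close>, so the extra domain conditions hold
  automatically.\<close>

lemma opdom_schur1:
  assumes "0 \<in> op_resolvent_set (entry22 M)" "opdom (entry22 M) \<subseteq> opdom (entry12 M)"
  shows "opdom (schur1 M) = dom1 M"
  using assms zero_in_op_resolvent_setD(1,2)[OF assms(1)] by (auto simp: schur1_def Let_def)

lemma opapp_schur1:
  "opapp (schur1 M) f = opapp (entry11 M) f -
    opapp (entry12 M) (opapp (op_inverse (entry22 M)) (opapp (entry21 M) f))"
  by (simp add: schur1_def Let_def)

lemma linear_op_schur1:
  assumes lin: "linear_op (entry11 M)" "linear_op (entry12 M)" "linear_op (entry21 M)"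
    and res: "0 \<in> op_resolvent_set (entry22 M)" and dom: "opdom (entry22 M) \<subseteq> opdom (entry12 M)"
  shows "linear_op (schur1 M)"
proof -
  let ?R = "opapp (op_inverse (entry22 M))"
  have R: "?R (x + y) = ?R x + ?R y" "?R (c *\<^sub>C x) = c *\<^sub>C ?R x" for x y c
    using zero_in_op_resolvent_setD(5)[OF res]
    by (auto simp: bounded_clinear_def bounded_linear.linear linear_add)
  have R_dom: "?R x \<in> opdom (entry12 M)" for x
    using dom zero_in_op_resolvent_setD(2)[OF res] by blast
  have "complex_vector.subspace (dom1 M)"
    using lin unfolding dom1_def linear_op_def by (auto intro: complex_vector.subspace_inter)
  then show ?thesis
    using lin R_dom unfolding linear_op_def opdom_schur1[OF res dom] opapp_schur1
    by (auto simp: dom1_def R complex_vector.scale_right_diff_distrib)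
qed

text \<open>The Schur complement arises from the operator matrix by eliminating \<open>g\<close>: the first row
  minus \<open>B D\<^sup>-\<^sup>1\<close> times the second one, where \<open>B D\<^sup>-\<^sup>1\<close> is bounded by relative boundedness.\<close>

lemma norm_schur1_le:
  assumes lin: "linear_op (entry12 M)" and res: "0 \<in> op_resolvent_set (entry22 M)"
    and bdd: "relatively_bounded (entry12 M) (entry22 M)"
  obtains K where "K > 0" "\<And>f g. f \<in> dom1 M \<Longrightarrow> g \<in> dom2 M \<Longrightarrow> norm (opapp (schur1 M) f) \<le>
    norm (opapp (entry11 M) f + opapp (entry12 M) g) +
    K * norm (opapp (entry21 M) f + opapp (entry22 M) g)"
proof -
  let ?R = "opapp (op_inverse (entry22 M))"
  obtain a b where ab: "a \<ge> 0" "b \<ge> 0" and dom: "opdom (entry22 M) \<subseteq> opdom (entry12 M)"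
    and le: "\<And>x. x \<in> opdom (entry22 M) \<Longrightarrow>
      norm (opapp (entry12 M) x) \<le> a * norm x + b * norm (opapp (entry22 M) x)"
    using bdd unfolding relatively_bounded_def by blast
  note R = zero_in_op_resolvent_setD(2-4)[OF res]
  have R_lin: "bounded_linear ?R"
    using zero_in_op_resolvent_setD(5)[OF res] by (simp add: bounded_clinear_def)
  obtain c where c: "c > 0" "\<And>y. norm (?R y) \<le> norm y * c"
    using bounded_linear.pos_bounded[OF R_lin] by blast
  show thesis
  proof
    \<comment> \<open>With \<open>c\<close> a bound for the inverse of \<open>D\<close>, the norm of
      \<open>B\<close> after this inverse is at most \<open>a * c + b\<close>; the 1 makes the
      constant positive.\<close>
    show "a * c + b + 1 > 0" using ab c by (simp add: add_nonneg_pos)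
    fix f g assume f: "f \<in> dom1 M" and g: "g \<in> dom2 M"
    define h where "h = opapp (entry21 M) f + opapp (entry22 M) g"
    \<comment> \<open>Applying the inverse of \<open>D\<close> to the second row \<open>h\<close>
      expresses the eliminated vector through \<open>g\<close> and \<open>h\<close>; applying
      \<open>B\<close> then brings in the first row.\<close>
    have "?R (opapp (entry21 M) f) = ?R (h - opapp (entry22 M) g)" by (simp add: h_def)
    also have "\<dots> = ?R h - g"
      using g R(3) by (simp add: bounded_linear.linear[OF R_lin] linear_diff dom2_def)
    finally have *: "?R (opapp (entry21 M) f) + g = ?R h" by simp
    have "opapp (entry12 M) (?R h) = opapp (entry12 M) (?R (opapp (entry21 M) f)) + opapp (entry12 M) g"
      using lin g dom R(1) unfolding linear_op_def *[symmetric] by (auto simp: dom2_def)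
    then have "opapp (schur1 M) f =
      (opapp (entry11 M) f + opapp (entry12 M) g) - opapp (entry12 M) (?R h)"
      by (simp add: opapp_schur1)
    then have "norm (opapp (schur1 M) f) \<le>
        norm (opapp (entry11 M) f + opapp (entry12 M) g) + norm (opapp (entry12 M) (?R h))"
      by (simp add: norm_triangle_ineq4)
    also have "norm (opapp (entry12 M) (?R h)) \<le> a * norm (?R h) + b * norm h"
      using le[OF R(1)] R(2) by simp
    also have "\<dots> \<le> a * (norm h * c) + b * norm h"
      using ab c by (intro add_right_mono mult_left_mono) auto
    also have "\<dots> \<le> (a * c + b + 1) * norm h" by (simp add: algebra_simps)
    finally show "norm (opapp (schur1 M) f) \<le>
      norm (opapp (entry11 M) f + opapp (entry12 M) g) +
      (a * c + b + 1) * norm (opapp (entry21 M) f + opapp (entry22 M) g)"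
      by (simp add: h_def)
  qed
qed

text \<open>In the two diagonal products with \<open>f\<close> and \<open>g\<close> the off-diagonal terms have opposite real parts,
  so accretivity leaves only the form of \<open>D\<close>, which sectoriality bounds.\<close>

lemma cmod_entry22_form_le:
  assumes pq: "p = 1 \<or> p = - 1" "q = 1 \<or> q = - 1"
    and acc: "accretive (op_scale p (entry11 M))"
    and sec: "\<And>g. g \<in> dom2 M \<Longrightarrow> c * cmod (cinner (opapp (entry22 M) g) g) \<le>
      Re (q * cinner (opapp (entry22 M) g) g)"
    and off: "\<And>f g. f \<in> dom1 M \<Longrightarrow> g \<in> dom2 M \<Longrightarrow>
      cinner (opapp (entry21 M) f) g = - (p * q) * cnj (cinner (opapp (entry12 M) g) f)"
    and f: "f \<in> dom1 M" and g: "g \<in> dom2 M"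
  shows "c * cmod (cinner (opapp (entry22 M) g) g) \<le>
    norm (opapp (entry11 M) f + opapp (entry12 M) g) * norm f +
    norm (opapp (entry21 M) f + opapp (entry22 M) g) * norm g"
proof -
  let ?a = "cinner (opapp (entry11 M) f) f" and ?b = "cinner (opapp (entry12 M) g) f"
  let ?c = "cinner (opapp (entry21 M) f) g" and ?d = "cinner (opapp (entry22 M) g) g"
  have "Re (p * ?a) \<ge> 0"
    using acc f unfolding accretive_def op_scale_def dom1_def by (auto simp: cinner_scaleC_left)
  \<comment> \<open>As q^2 = 1, \<open>off\<close> gives \<open>q * ?c = - p * cnj ?b\<close>. Since
    \<open>p\<close> is real, its real part cancels that of \<open>p * ?b\<close>.\<close>
  moreover have "Re (p * (?a + ?b)) + Re (q * (?c + ?d)) = Re (p * ?a) + Re (q * ?d)"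
    using pq off[OF f g] by auto
  moreover have "Re (p * (?a + ?b)) \<le> norm (opapp (entry11 M) f + opapp (entry12 M) g) * norm f"
    using complex_Re_le_cmod[of "p * (?a + ?b)"] pq
      cinner_Cauchy_Schwarz[of "opapp (entry11 M) f + opapp (entry12 M) g" f]
    by (auto simp: norm_mult cinner_add_left)
  moreover have "Re (q * (?c + ?d)) \<le> norm (opapp (entry21 M) f + opapp (entry22 M) g) * norm g"
    using complex_Re_le_cmod[of "q * (?c + ?d)"] pq
      cinner_Cauchy_Schwarz[of "opapp (entry21 M) f + opapp (entry22 M) g" g]
    by (auto simp: norm_mult cinner_add_left)
  ultimately show ?thesis using sec[OF g] by linarith
qed

section \<open>Approximate point spectrum of the operator matrix\<close>

lemma fam_ap_spectrum_matrix_opD: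
  assumes "z \<in> fam_ap_spectrum \<Omega> (\<lambda>z. matrix_op (L z))" "\<epsilon> > 0"
  obtains f g where "f \<in> dom1 (L z)" "g \<in> dom2 (L z)" "(norm f)\<^sup>2 + (norm g)\<^sup>2 = 1"
    "norm (opapp (entry11 (L z)) f + opapp (entry12 (L z)) g) < \<epsilon>"
    "norm (opapp (entry21 (L z)) f + opapp (entry22 (L z)) g) < \<epsilon>"
proof -
  obtain x where x: "\<And>n::nat. x n \<in> opdom (matrix_op (L z))" "\<And>n. norm (x n) = 1"
    and lim: "(\<lambda>n. opapp (matrix_op (L z)) (x n)) \<longlonglongrightarrow> 0"
    using assms unfolding fam_ap_spectrum_def by blast
  obtain n where n: "norm (opapp (matrix_op (L z)) (x n)) < \<epsilon>"
    using LIMSEQ_D[OF lim assms(2)] by auto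
  obtain f g where fg: "x n = (f, g)" by fastforce
  have "(norm f)\<^sup>2 + (norm g)\<^sup>2 = 1" using x(2)[of n] by (simp add: fg norm_Pair)
  moreover have "f \<in> dom1 (L z)" "g \<in> dom2 (L z)" using x(1)[of n] by (simp_all add: fg matrix_op_def)
  moreover have "norm (opapp (entry11 (L z)) f + opapp (entry12 (L z)) g) < \<epsilon>"
    "norm (opapp (entry21 (L z)) f + opapp (entry22 (L z)) g) < \<epsilon>"
    using n by (auto simp: fg matrix_op_def intro: order_le_less_trans norm_fst_le norm_snd_le)
  ultimately show thesis using that by blast
qed

text \<open>The two signs \<open>p\<close> and \<open>q\<close> cover both parts of the theorem and
  both choices of the sign. Outside the pseudo numerical range the form of \<open>D\<close> has a
  positive lower bound, so \<open>cmod_entry22_form_le\<close> bounds \<open>g\<close> and keeps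
  \<open>f\<close> away from 0; \<open>norm_schur1_le\<close> does the rest.\<close>

lemma fam_ap_spectrum_matrix_op_subset:
  fixes L :: "('a::complex_hilbert, 'b::complex_hilbert) op_matrix_family"
  assumes lin: "linear_op (entry11 (L z))" "linear_op (entry12 (L z))" "linear_op (entry21 (L z))"
    and pq: "p = 1 \<or> p = - 1" "q = 1 \<or> q = - 1"
    and res: "z \<in> fam_resolvent_set \<Omega> (\<lambda>z. entry22 (L z))"
    and acc: "accretive (op_scale p (entry11 (L z)))" and sec: "sectorial (op_scale q (entry22 (L z)))"
    and bdd: "relatively_bounded (entry12 (L z)) (entry22 (L z))"
    and off: "\<And>f g. f \<in> dom1 (L z) \<Longrightarrow> g \<in> dom2 (L z) \<Longrightarrow>
      cinner (opapp (entry21 (L z)) f) g = - (p * q) * cnj (cinner (opapp (entry12 (L z)) g) f)"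
    and ap: "z \<in> fam_ap_spectrum \<Omega> (\<lambda>z. matrix_op (L z))"
    and notin: "z \<notin> pseudo_num_range \<Omega> (\<lambda>z. entry22 (L z))"
  shows "z \<in> fam_ap_spectrum (fam_resolvent_set \<Omega> (\<lambda>z. entry22 (L z))) (\<lambda>z. schur1 (L z))"
proof -
  have z: "z \<in> \<Omega>" and res0: "0 \<in> op_resolvent_set (entry22 (L z))"
    using res by (simp_all add: fam_resolvent_set_iff)
  have dom: "opdom (entry22 (L z)) \<subseteq> opdom (entry12 (L z))"
    using bdd by (simp add: relatively_bounded_def)
  obtain \<delta> where \<delta>: "\<delta> > 0" "\<And>g. g \<in> opdom (entry22 (L z)) \<Longrightarrow>
      \<delta> * (norm g)\<^sup>2 \<le> cmod (cinner (opapp (entry22 (L z)) g) g)"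
    using notin z unfolding pseudo_num_range_iff by (auto simp: not_less)
  obtain c where c: "c > 0" "\<And>f. f \<in> opdom (op_scale q (entry22 (L z))) \<Longrightarrow>
      c * cmod (cinner (opapp (op_scale q (entry22 (L z))) f) f) \<le>
      Re (cinner (opapp (op_scale q (entry22 (L z))) f) f)"
    using sectorial_cmod_le_Re[OF sec] by blast
  have c': "c * cmod (cinner (opapp (entry22 (L z)) g) g) \<le>
      Re (q * cinner (opapp (entry22 (L z)) g) g)" if "g \<in> dom2 (L z)" for g
    using c(2)[of g] that pq by (auto simp: op_scale_def dom2_def cinner_scaleC_left norm_mult)
  obtain K where K: "K > 0" "\<And>f g. f \<in> dom1 (L z) \<Longrightarrow> g \<in> dom2 (L z) \<Longrightarrow>
    norm (opapp (schur1 (L z)) f) \<le> norm (opapp (entry11 (L z)) f + opapp (entry12 (L z)) g) +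
      K * norm (opapp (entry21 (L z)) f + opapp (entry22 (L z)) g)"
    using norm_schur1_le[OF lin(2) res0 bdd] by blast
  have "\<exists>f\<in>opdom (schur1 (L z)). norm (opapp (schur1 (L z)) f) < \<epsilon> * norm f" if "\<epsilon> > 0" for \<epsilon> :: real
  proof -
    \<comment> \<open>The first bound yields |g|^2 < 3/4, hence |f| > 1/2. The second keeps (1 + K)
      \<eta> at most \<epsilon>/2, which is then less than \<epsilon> |f|.\<close>
    define \<eta> where "\<eta> = min (3 * c * \<delta> / 8) (\<epsilon> / (2 * (1 + K)))"
    have "\<eta> > 0" using that c \<delta> K by (simp add: \<eta>_def)
    have \<eta>: "2 * \<eta> \<le> c * \<delta> * (3/4)"
      using min.cobounded1[of "3 * c * \<delta> / 8" "\<epsilon> / (2 * (1 + K))"] by (simp add: \<eta>_def)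
    have "(1 + K) * \<eta> \<le> (1 + K) * (\<epsilon> / (2 * (1 + K)))"
      using K by (intro mult_left_mono) (simp_all add: \<eta>_def)
    also have "\<dots> = \<epsilon> / 2" using K by (simp add: field_simps)
    finally have \<eta>': "(1 + K) * \<eta> \<le> \<epsilon> / 2" .
    obtain f g where fg: "f \<in> dom1 (L z)" "g \<in> dom2 (L z)" "(norm f)\<^sup>2 + (norm g)\<^sup>2 = 1"
      and r1: "norm (opapp (entry11 (L z)) f + opapp (entry12 (L z)) g) < \<eta>" (is "?r1 < _")
      and r2: "norm (opapp (entry21 (L z)) f + opapp (entry22 (L z)) g) < \<eta>" (is "?r2 < _")
      using fam_ap_spectrum_matrix_opD[OF ap \<open>\<eta> > 0\<close>] by blast
    have le1: "norm f \<le> 1" "norm g \<le> 1"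
      using fg(3) by (metis abs_norm_cancel abs_square_le_1 le_add_same_cancel1 zero_le_power2,
        metis abs_norm_cancel abs_square_le_1 le_add_same_cancel2 zero_le_power2)
    have "c * \<delta> * (norm g)\<^sup>2 \<le> c * cmod (cinner (opapp (entry22 (L z)) g) g)"
      using \<delta>(2)[of g] fg(2) c(1) by (simp add: dom2_def mult.assoc)
    also have "\<dots> \<le> ?r1 * norm f + ?r2 * norm g"
      by (rule cmod_entry22_form_le[OF pq acc c' off fg(1,2)])
    also have "\<dots> \<le> ?r1 * 1 + ?r2 * 1"
      using le1 by (intro add_mono mult_left_mono) auto
    also have "\<dots> < c * \<delta> * (3/4)" using r1 r2 \<eta> by linarith
    finally have "(norm g)\<^sup>2 < 3 / 4" using c(1) \<delta>(1) by simp
    then have "(1/2)\<^sup>2 < (norm f)\<^sup>2" using fg(3) by (simp add: power2_eq_square)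
    then have half: "1 / 2 < norm f" by (rule power2_less_imp_less) simp
    have "norm (opapp (schur1 (L z)) f) \<le> ?r1 + K * ?r2" by (rule K(2)[OF fg(1,2)])
    also have "\<dots> \<le> \<eta> + K * \<eta>" using K(1) r1 r2 by (intro add_mono mult_left_mono) auto
    also have "\<dots> \<le> \<epsilon> * (1/2)" using \<eta>' by (simp add: algebra_simps)
    also have "\<dots> < \<epsilon> * norm f" using half that by simp
    finally show ?thesis using fg(1) opdom_schur1[OF res0 dom] by blast
  qed
  then show ?thesis
    using res by (simp add: fam_ap_spectrum_iff[where T = "\<lambda>z. schur1 (L z)" and z = z, OF linear_op_schur1[OF lin res0 dom]])
qed

section \<open>Inclusions in the pseudo quadratic numerical range\<close>

lemma pseudo_num_range_schur1_subset:
  assumes lin: "linear_op (entry11 (L z))" "linear_op (entry12 (L z))" "linear_op (entry21 (L z))"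
      "linear_op (entry22 (L z))"
    and res: "z \<in> fam_resolvent_set \<Omega> (\<lambda>z. entry22 (L z))"
    and dom: "opdom (entry22 (L z)) \<subseteq> opdom (entry12 (L z))"
    and nonzero: "\<exists>g\<in>dom2 (L z). g \<noteq> 0"
    and W: "z \<in> pseudo_num_range (fam_resolvent_set \<Omega> (\<lambda>z. entry22 (L z))) (\<lambda>z. schur1 (L z))"
  shows "z \<in> pseudo_quad_num_range_diag \<Omega> L"
proof (rule pseudo_quad_num_range_diagI[where L = L and z = z, OF _ lin])
  show "z \<in> \<Omega>" using res by (simp add: fam_resolvent_set_iff)
  have res0: "0 \<in> op_resolvent_set (entry22 (L z))"
    using res by (simp add: fam_resolvent_set_iff)
  fix \<epsilon> :: real assume "\<epsilon> > 0"
  obtain f where f: "f \<in> dom1 (L z)"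
    and less: "cmod (cinner (opapp (schur1 (L z)) f) f) < \<epsilon> * (norm f)\<^sup>2"
    using W \<open>\<epsilon> > 0\<close> opdom_schur1[OF res0 dom] unfolding pseudo_num_range_iff by auto
  have "f \<noteq> 0" using less by auto
  define \<alpha> where "\<alpha> = - cinner (opapp (schur1 (L z)) f) f / cinner f f"
  have \<alpha>: "cmod \<alpha> < \<epsilon>"
    using less \<open>f \<noteq> 0\<close> by (simp add: \<alpha>_def norm_divide cinner_self divide_less_eq norm_power)
  let ?R = "opapp (op_inverse (entry22 (L z)))"
  define h where "h = ?R (opapp (entry21 (L z)) f)"
  have h: "h \<in> dom2 (L z)" "opapp (entry22 (L z)) h = opapp (entry21 (L z)) f"
    using zero_in_op_resolvent_setD(2,3)[OF res0] dom by (auto simp: h_def dom2_def)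
  \<comment> \<open>The shift \<alpha> cancels the form of the Schur complement, and what remains of
    the form of \<open>A\<close> is the term with \<open>B\<close>. With \<open>D h = C f\<close>
    this is the determinant equation for \<open>g = h\<close> and \<beta> = 0.\<close>
  have a: "cinner (opapp (entry11 (L z)) f) f + \<alpha> * cinner f f = cinner (opapp (entry12 (L z)) h) f"
    using \<open>f \<noteq> 0\<close> by (simp add: \<alpha>_def opapp_schur1 cinner_diff_left cinner_self flip: h_def)
  show "\<exists>f\<in>dom1 (L z). \<exists>g\<in>dom2 (L z). \<exists>\<alpha> \<beta>.
      f \<noteq> 0 \<and> g \<noteq> 0 \<and> cmod \<alpha> < \<epsilon> \<and> cmod \<beta> < \<epsilon> \<and>
      (cinner (opapp (entry11 (L z)) f) f + \<alpha> * cinner f f) *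
        (cinner (opapp (entry22 (L z)) g) g + \<beta> * cinner g g) =
      cinner (opapp (entry12 (L z)) g) f * cinner (opapp (entry21 (L z)) f) g"
  proof (cases "h = 0")
    \<comment> \<open>Here \<open>h\<close> cannot be normalised. But \<open>C f = D h = 0\<close>
      and \<open>B h = 0\<close>, so both sides of the equation vanish for every
      \<open>g\<close>.\<close>
    case True
    have zero: "opapp (entry12 (L z)) h = 0" "opapp (entry21 (L z)) f = 0"
      using True linear_op_zero[OF lin(2)] linear_op_zero[OF lin(4)] h(2) by simp_all
    obtain g where "g \<in> dom2 (L z)" "g \<noteq> 0" using nonzero by blast
    then show ?thesis
      using f \<open>f \<noteq> 0\<close> \<alpha> a \<open>\<epsilon> > 0\<close> unfolding zero
      by (intro bexI[of _ f] bexI[of _ g] exI[of _ \<alpha>] exI[of _ 0])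
        (simp_all add: zero cinner.zero_left)
  next
    case False
    then show ?thesis
      using f \<open>f \<noteq> 0\<close> \<alpha> a \<open>\<epsilon> > 0\<close> h
      by (intro bexI[of _ f] bexI[of _ h] exI[of _ \<alpha>] exI[of _ 0]) simp_all
  qed
qed

text \<open>The core yields \<open>g\<close> in both domains of the second column. The shift \<beta>
  annihilates the factor of \<open>D\<close>, and an \<open>f\<close> orthogonal to
  \<open>B g\<close> annihilates the off-diagonal product, so \<alpha> = 0 will do.\<close>

lemma pseudo_num_range_entry22_subset:
  fixes L :: "('a::complex_hilbert, 'b::complex_hilbert) op_matrix_family"
  assumes lin: "linear_op (entry11 (L z))" "linear_op (entry12 (L z))" "linear_op (entry21 (L z))"
      "linear_op (entry22 (L z))"
    and dim: "cdim_gt_1 TYPE('a)" and dense: "closure (dom1 (L z)) = UNIV"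
    and core: "is_core (dom2 (L z)) (entry22 (L z))"
    and W: "z \<in> pseudo_num_range \<Omega> (\<lambda>z. entry22 (L z))"
  shows "z \<in> pseudo_quad_num_range_diag \<Omega> L"
proof (rule pseudo_quad_num_range_diagI[where L = L and z = z, OF _ lin])
  show "z \<in> \<Omega>" using W by (simp add: pseudo_num_range_iff)
  fix \<epsilon> :: real assume "\<epsilon> > 0"
  then obtain g where g: "g \<in> dom2 (L z)"
    and less: "cmod (cinner (opapp (entry22 (L z)) g) g) < \<epsilon> * (norm g)\<^sup>2"
    using W is_core_quadratic_form_small[OF core] unfolding pseudo_num_range_iff by meson
  have "g \<noteq> 0" using less by auto
  define \<beta> where "\<beta> = - cinner (opapp (entry22 (L z)) g) g / cinner g g"
  have \<beta>: "cmod \<beta> < \<epsilon>"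
    using less \<open>g \<noteq> 0\<close> by (simp add: \<beta>_def norm_divide cinner_self divide_less_eq norm_power)
  have "complex_vector.subspace (dom1 (L z))"
    using lin unfolding dom1_def linear_op_def by (auto intro: complex_vector.subspace_inter)
  then obtain f where f: "f \<in> dom1 (L z)" "f \<noteq> 0" "cinner (opapp (entry12 (L z)) g) f = 0"
    using ex_orthogonal_in_dense_subspace[OF dim _ dense] by blast
  show "\<exists>f\<in>dom1 (L z). \<exists>g\<in>dom2 (L z). \<exists>\<alpha> \<beta>.
      f \<noteq> 0 \<and> g \<noteq> 0 \<and> cmod \<alpha> < \<epsilon> \<and> cmod \<beta> < \<epsilon> \<and>
      (cinner (opapp (entry11 (L z)) f) f + \<alpha> * cinner f f) *
        (cinner (opapp (entry22 (L z)) g) g + \<beta> * cinner g g) =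
      cinner (opapp (entry12 (L z)) g) f * cinner (opapp (entry21 (L z)) f) g"
    using f g \<open>g \<noteq> 0\<close> \<beta> \<open>\<epsilon> > 0\<close>
    by (intro bexI[of _ f] bexI[of _ g] exI[of _ 0] exI[of _ \<beta>])
      (simp_all add: \<beta>_def cinner_self)
qed

section \<open>The chain of inclusions for the first Schur complement\<close>

lemma schur1_spectral_inclusions:
  fixes L :: "('a::complex_hilbert, 'b::complex_hilbert) op_matrix_family"
  assumes nonzero: "\<exists>g::'b. g \<noteq> 0"
    and lin: "\<And>z. z \<in> \<Omega> \<Longrightarrow> linear_op (entry11 (L z))" "\<And>z. z \<in> \<Omega> \<Longrightarrow> linear_op (entry12 (L z))"
      "\<And>z. z \<in> \<Omega> \<Longrightarrow> linear_op (entry21 (L z))" "\<And>z. z \<in> \<Omega> \<Longrightarrow> linear_op (entry22 (L z))"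
    and dense: "\<And>z. z \<in> \<Omega> \<Longrightarrow> closure (dom1 (L z)) = UNIV" "\<And>z. z \<in> \<Omega> \<Longrightarrow> closure (dom2 (L z)) = UNIV"
    and pq: "p = 1 \<or> p = - 1" "q = 1 \<or> q = - 1"
    and hyps: "\<And>z. z \<in> fam_resolvent_set \<Omega> (\<lambda>z. entry22 (L z)) \<Longrightarrow>
      accretive (op_scale p (entry11 (L z))) \<and> sectorial (op_scale q (entry22 (L z))) \<and>
      relatively_bounded (entry12 (L z)) (entry22 (L z))"
    and off: "\<And>z f g. \<lbrakk>z \<in> fam_resolvent_set \<Omega> (\<lambda>z. entry22 (L z)); f \<in> dom1 (L z); g \<in> dom2 (L z)\<rbrakk> \<Longrightarrow>
      cinner (opapp (entry21 (L z)) f) g = - (p * q) * cnj (cinner (opapp (entry12 (L z)) g) f)"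
    and dim: "cdim_gt_1 TYPE('a)"
    and spec: "fam_spectrum \<Omega> (\<lambda>z. entry22 (L z)) \<subseteq> pseudo_num_range \<Omega> (\<lambda>z. entry22 (L z))"
  defines "\<rho> \<equiv> fam_resolvent_set \<Omega> (\<lambda>z. entry22 (L z))"
    and "W \<equiv> pseudo_num_range \<Omega> (\<lambda>z. entry22 (L z))"
  shows "fam_ap_spectrum \<Omega> (\<lambda>z. matrix_op (L z)) \<subseteq> fam_ap_spectrum \<rho> (\<lambda>z. schur1 (L z)) \<union> W \<and>
    fam_ap_spectrum \<rho> (\<lambda>z. schur1 (L z)) \<union> W \<subseteq> pseudo_num_range \<rho> (\<lambda>z. schur1 (L z)) \<union> W \<and>
    ((\<forall>z\<in>fam_spectrum \<Omega> (\<lambda>z. entry22 (L z)). is_core (dom2 (L z)) (entry22 (L z))) \<longrightarrow>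
      pseudo_num_range \<rho> (\<lambda>z. schur1 (L z)) \<union> W \<subseteq> pseudo_quad_num_range_diag \<Omega> L)"
proof (intro conjI impI)
  show "fam_ap_spectrum \<Omega> (\<lambda>z. matrix_op (L z)) \<subseteq> fam_ap_spectrum \<rho> (\<lambda>z. schur1 (L z)) \<union> W"
  proof
    fix z assume z: "z \<in> fam_ap_spectrum \<Omega> (\<lambda>z. matrix_op (L z))"
    then have "z \<in> \<Omega>" by (simp add: fam_ap_spectrum_def)
    show "z \<in> fam_ap_spectrum \<rho> (\<lambda>z. schur1 (L z)) \<union> W"
    proof (cases "z \<in> W")
      case False
      \<comment> \<open>Outside \<open>W\<close> the inclusion \<open>spec\<close> rules out the
        spectrum of \<open>D\<close>, so the assumptions on the entries are available.\<close>
      then have "z \<in> fam_resolvent_set \<Omega> (\<lambda>z. entry22 (L z))"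
        using spec \<open>z \<in> \<Omega>\<close> by (auto simp: fam_resolvent_set_def W_def)
      then show ?thesis
        using fam_ap_spectrum_matrix_op_subset[OF lin(1-3)[OF \<open>z \<in> \<Omega>\<close>] pq _ _ _ _ off z] hyps False
        unfolding \<rho>_def W_def by blast
    qed simp
  qed
  show "fam_ap_spectrum \<rho> (\<lambda>z. schur1 (L z)) \<union> W \<subseteq> pseudo_num_range \<rho> (\<lambda>z. schur1 (L z)) \<union> W"
    using fam_ap_spectrum_subset_pseudo_num_range by blast
  assume core: "\<forall>z\<in>fam_spectrum \<Omega> (\<lambda>z. entry22 (L z)). is_core (dom2 (L z)) (entry22 (L z))"
  show "pseudo_num_range \<rho> (\<lambda>z. schur1 (L z)) \<union> W \<subseteq> pseudo_quad_num_range_diag \<Omega> L"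
  proof (intro Un_least subsetI)
    fix z assume z: "z \<in> pseudo_num_range \<rho> (\<lambda>z. schur1 (L z))"
    then have res: "z \<in> fam_resolvent_set \<Omega> (\<lambda>z. entry22 (L z))"
      by (simp add: pseudo_num_range_iff \<rho>_def)
    then have "z \<in> \<Omega>" by (simp add: fam_resolvent_set_iff)
    \<comment> \<open>A dense subset of a nonzero space cannot be contained in {0}.\<close>
    have "\<exists>g\<in>dom2 (L z). g \<noteq> 0"
    proof (rule ccontr)
      assume "\<not> ?thesis"
      then have "closure (dom2 (L z)) \<subseteq> {0}" by (intro closure_minimal) auto
      then show False using nonzero dense(2)[OF \<open>z \<in> \<Omega>\<close>] by auto
    qed
    then show "z \<in> pseudo_quad_num_range_diag \<Omega> L"
      using pseudo_num_range_schur1_subset[OF lin[OF \<open>z \<in> \<Omega>\<close>] res] hyps[OF res] z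
      by (simp add: relatively_bounded_def \<rho>_def)
  next
    fix z assume z: "z \<in> W"
    then have "z \<in> \<Omega>" by (simp add: pseudo_num_range_iff W_def)
    have "is_core (dom2 (L z)) (entry22 (L z))"
    proof (cases "z \<in> fam_spectrum \<Omega> (\<lambda>z. entry22 (L z))")
      case False
      \<comment> \<open>On the resolvent set relative boundedness puts the domain of
        \<open>D\<close> inside that of \<open>B\<close>, and the full domain is trivially a
        core.\<close>
      then have "dom2 (L z) = opdom (entry22 (L z))"
        using hyps[of z] \<open>z \<in> \<Omega>\<close>
        by (auto simp: fam_resolvent_set_def relatively_bounded_def dom2_def)
      then show ?thesis
        by (simp add: is_core_def op_graph_def op_restrict_def closure_subset)
    qed (use core in blast)
    then show "z \<in> pseudo_quad_num_range_diag \<Omega> L"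
      using pseudo_num_range_entry22_subset[where L = L and z = z, OF lin[OF \<open>z \<in> \<Omega>\<close>] dim dense(1)[OF \<open>z \<in> \<Omega>\<close>]] z
      unfolding W_def by blast
  qed
qed

section \<open>Exchanging the two components\<close>

definition op_matrix_swap :: "('a, 'b) op_matrix \<Rightarrow> ('b, 'a) op_matrix"
  where "op_matrix_swap M = Op_Matrix (entry22 M) (entry21 M) (entry12 M) (entry11 M)"

lemma op_matrix_swap_simps [simp]:
  "entry11 (op_matrix_swap M) = entry22 M" "entry12 (op_matrix_swap M) = entry21 M"
  "entry21 (op_matrix_swap M) = entry12 M" "entry22 (op_matrix_swap M) = entry11 M"
  "dom1 (op_matrix_swap M) = dom2 M" "dom2 (op_matrix_swap M) = dom1 M"
  by (auto simp: op_matrix_swap_def dom1_def dom2_def)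

lemma schur1_op_matrix_swap: "schur1 (op_matrix_swap M) = schur2 M"
  by (simp add: schur1_def schur2_def Let_def)

text \<open>Exchanging components is an isometry that intertwines the two matrix operators, so it
  carries approximate null vectors over.\<close>

lemma fam_ap_spectrum_op_matrix_swap:
  "fam_ap_spectrum \<Omega> (\<lambda>z. matrix_op (L z)) \<subseteq> fam_ap_spectrum \<Omega> (\<lambda>z. matrix_op (op_matrix_swap (L z)))"
proof
  fix z assume "z \<in> fam_ap_spectrum \<Omega> (\<lambda>z. matrix_op (L z))"
  then obtain x where z: "z \<in> \<Omega>" and x: "\<And>n::nat. x n \<in> opdom (matrix_op (L z))"
    "\<And>n. norm (x n) = 1" and lim: "(\<lambda>n. opapp (matrix_op (L z)) (x n)) \<longlonglongrightarrow> 0"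
    unfolding fam_ap_spectrum_def by blast
  have "opapp (matrix_op (op_matrix_swap (L z))) (prod.swap (x n)) =
    prod.swap (opapp (matrix_op (L z)) (x n))" for n
    by (simp add: matrix_op_def case_prod_unfold add.commute)
  moreover have "(\<lambda>n. prod.swap (opapp (matrix_op (L z)) (x n))) \<longlonglongrightarrow> 0"
    using tendsto_Pair[OF tendsto_snd[OF lim] tendsto_fst[OF lim]]
    by (simp add: prod.swap_def zero_prod_def)
  moreover have "prod.swap (x n) \<in> opdom (matrix_op (op_matrix_swap (L z)))" "norm (prod.swap (x n)) = 1" for n
    using x[of n] by (auto simp: matrix_op_def norm_prod_def add.commute)
  ultimately show "z \<in> fam_ap_spectrum \<Omega> (\<lambda>z. matrix_op (op_matrix_swap (L z)))"
    using z unfolding fam_ap_spectrum_def by (auto intro!: exI[of _ "\<lambda>n. prod.swap (x n)"])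
qed

text \<open>The determinant is unchanged when \<open>f\<close> and \<open>g\<close> trade places,
  and the two diagonal perturbations obey the same norm bound.\<close>

lemma pseudo_quad_num_range_diag_op_matrix_swap:
  fixes L :: "('a::complex_hilbert, 'b::complex_hilbert) op_matrix_family"
  shows "pseudo_quad_num_range_diag \<Omega> (\<lambda>z. op_matrix_swap (L z)) \<subseteq> pseudo_quad_num_range_diag \<Omega> L"
proof -
  have sub: "quad_num_range \<Omega> (\<lambda>z. matrix_plus (op_matrix_swap (L z)) (bdiag B1 B2)) \<subseteq>
    quad_num_range \<Omega> (\<lambda>z. matrix_plus (L z) (bdiag B2 B1))" for B1 :: "'b \<Rightarrow> 'b" and B2 :: "'a \<Rightarrow> 'a"
    unfolding quad_num_range_def
    by (auto simp: matrix_plus_def op_plus_def bdiag_def dom1_def dom2_def op_matrix_swap_def mult.commute)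
  show ?thesis
    unfolding pseudo_quad_num_range_diag_def
  proof (intro INT_anti_mono order_refl UN_least)
    fix \<epsilon> :: real and B1 :: "'b \<Rightarrow> 'b" and B2 :: "'a \<Rightarrow> 'a"
    assume "B1 \<in> {B1. bounded_clinear B1 \<and> onorm B1 < \<epsilon>}" "B2 \<in> {B2. bounded_clinear B2 \<and> onorm B2 < \<epsilon>}"
    then show "quad_num_range \<Omega> (\<lambda>z. matrix_plus (op_matrix_swap (L z)) (bdiag B1 B2)) \<subseteq>
      (\<Union>B1\<in>{B1. bounded_clinear B1 \<and> onorm B1 < \<epsilon>}. \<Union>B2\<in>{B2. bounded_clinear B2 \<and> onorm B2 < \<epsilon>}.
        quad_num_range \<Omega> (\<lambda>z. matrix_plus (L z) (bdiag B1 B2)))"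
      by (intro order_trans[OF sub] order_trans[OF _ UN_upper[of B2]] UN_upper)
  qed
qed

section \<open>The adjoint relation and the theorem\<close>

text \<open>Two candidates for the value of the adjoint differ by a vector orthogonal to the dense
  domain of \<open>B\<close>, so \<open>THE\<close> selects the representing vector. The operator
  inclusion thus becomes an identity of scalars.\<close>

lemma cinner_op_extends_adjoint:
  assumes ext: "C \<subseteq>\<^sub>o op_scale s (op_adjoint B)" and dense: "densely_defined B"
    and f: "f \<in> opdom C" and g: "g \<in> opdom B"
  shows "cinner (opapp C f) g = s * cnj (cinner (opapp B g) f)"
proof -
  let ?P = "\<lambda>h. \<forall>g\<in>opdom B. cinner (opapp B g) f = cinner g h"
  have "\<exists>h. ?P h" and C: "opapp C f = s *\<^sub>C (THE h. ?P h)"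
    using ext f unfolding op_extends_def op_scale_def op_adjoint_def by auto
  then obtain h where h: "?P h" by blast
  have "(THE h. ?P h) = h"
  proof (rule the_equality)
    show "h' = h" if "?P h'" for h'
    proof -
      have "h' - h = 0"
        using dense h that unfolding densely_defined_def
        by (intro eq_zero_if_orthogonal_to_dense[of "opdom B"]) (auto simp: cinner_diff_right)
      then show ?thesis by simp
    qed
  qed (rule h)
  then show ?thesis using h g C by (simp add: cinner_scaleC_left cinner_commute[of h g])
qed

text \<open>The number \<open>s\<close> is 1 for the upper and -1 for the lower signs, and
  \<open>- s\<close> carries the opposite sign. Both spaces are taken nonzero, since otherwise there
  are no pairs of unit vectors and the quadratic numerical ranges are empty. The third inclusion of
  each chain has a core condition as premise.\<close>

theorem corollary5p4:
  fixes \<Omega> :: "complex set"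
    and A :: "complex \<Rightarrow> ('a::complex_hilbert, 'a) operator"
    and B :: "complex \<Rightarrow> ('b::complex_hilbert, 'a) operator"
    and C :: "complex \<Rightarrow> ('a, 'b) operator"
    and D :: "complex \<Rightarrow> ('b, 'b) operator"
    and L :: "complex \<Rightarrow> ('a, 'b) op_matrix"
    and S1 :: "complex \<Rightarrow> ('a, 'a) operator"
    and S2 :: "complex \<Rightarrow> ('b, 'b) operator"
    and s :: complex
  assumes H1_nonzero: "\<exists>f::'a. f \<noteq> 0"
    and H2_nonzero: "\<exists>g::'b. g \<noteq> 0"
    and domain: "open \<Omega>" "connected \<Omega>" "\<Omega> \<noteq> {}"
    and A: "\<And>z. z \<in> \<Omega> \<Longrightarrow> linear_op (A z) \<and> densely_defined (A z) \<and> closable_op (A z)"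
    and B: "\<And>z. z \<in> \<Omega> \<Longrightarrow> linear_op (B z) \<and> densely_defined (B z) \<and> closable_op (B z)"
    and C: "\<And>z. z \<in> \<Omega> \<Longrightarrow> linear_op (C z) \<and> densely_defined (C z) \<and> closable_op (C z)"
    and D: "\<And>z. z \<in> \<Omega> \<Longrightarrow> linear_op (D z) \<and> densely_defined (D z) \<and> closable_op (D z)"
    and L: "L = (\<lambda>z. Op_Matrix (A z) (B z) (C z) (D z))"
    and L_dense: "\<And>z. z \<in> \<Omega> \<Longrightarrow> densely_defined (matrix_op (L z))"
    and S1: "S1 = (\<lambda>z. schur1 (L z))"
    and S2: "S2 = (\<lambda>z. schur2 (L z))"
    and sign: "s = 1 \<or> s = -1"
  shows
    "((\<forall>z\<in>fam_resolvent_set \<Omega> D.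
          C z \<subseteq>\<^sub>o op_scale s (op_adjoint (B z)) \<and> accretive (A z) \<and>
          sectorial (op_scale (- s) (D z)) \<and> relatively_bounded (B z) (D z)) \<and>
      cdim_gt_1 TYPE('a) \<and>
      fam_spectrum \<Omega> D \<subseteq> pseudo_num_range \<Omega> D \<longrightarrow>
        fam_ap_spectrum \<Omega> (\<lambda>z. matrix_op (L z))
          \<subseteq> fam_ap_spectrum (fam_resolvent_set \<Omega> D) S1 \<union> pseudo_num_range \<Omega> D \<and>
        fam_ap_spectrum (fam_resolvent_set \<Omega> D) S1 \<union> pseudo_num_range \<Omega> D
          \<subseteq> pseudo_num_range (fam_resolvent_set \<Omega> D) S1 \<union> pseudo_num_range \<Omega> D \<and>
        ((\<forall>z\<in>fam_spectrum \<Omega> D. is_core (dom2 (L z)) (D z)) \<longrightarrow>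
          pseudo_num_range (fam_resolvent_set \<Omega> D) S1 \<union> pseudo_num_range \<Omega> D
            \<subseteq> pseudo_quad_num_range_diag \<Omega> L) \<and>
        pseudo_quad_num_range_diag \<Omega> L \<subseteq> pseudo_quad_num_range \<Omega> L) \<and>
    ((\<forall>z\<in>fam_resolvent_set \<Omega> A.
          C z \<subseteq>\<^sub>o op_scale s (op_adjoint (B z)) \<and> sectorial (A z) \<and>
          accretive (op_scale (- s) (D z)) \<and> relatively_bounded (C z) (A z)) \<and>
      cdim_gt_1 TYPE('b) \<and>
      fam_spectrum \<Omega> A \<subseteq> pseudo_num_range \<Omega> A \<longrightarrow>
        fam_ap_spectrum \<Omega> (\<lambda>z. matrix_op (L z))
          \<subseteq> fam_ap_spectrum (fam_resolvent_set \<Omega> A) S2 \<union> pseudo_num_range \<Omega> A \<and>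
        fam_ap_spectrum (fam_resolvent_set \<Omega> A) S2 \<union> pseudo_num_range \<Omega> A
          \<subseteq> pseudo_num_range (fam_resolvent_set \<Omega> A) S2 \<union> pseudo_num_range \<Omega> A \<and>
        ((\<forall>z\<in>fam_spectrum \<Omega> A. is_core (dom1 (L z)) (A z)) \<longrightarrow>
          pseudo_num_range (fam_resolvent_set \<Omega> A) S2 \<union> pseudo_num_range \<Omega> A
            \<subseteq> pseudo_quad_num_range_diag \<Omega> L) \<and>
        pseudo_quad_num_range_diag \<Omega> L \<subseteq> pseudo_quad_num_range \<Omega> L)"
proof -
  have entries [simp]: "entry11 (L z) = A z" "entry12 (L z) = B z" "entry21 (L z) = C z"
    "entry22 (L z) = D z" for z by (simp_all add: L)
  have lin: "linear_op (A z)" "linear_op (B z)" "linear_op (C z)" "linear_op (D z)" if "z \<in> \<Omega>" for z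
    using A B C D that by blast+
  have dense: "closure (dom1 (L z)) = UNIV" "closure (dom2 (L z)) = UNIV" if "z \<in> \<Omega>" for z
  proof -
    \<comment> \<open>The closure of a product is the product of the closures, so density of the
      matrix domain passes to both factors.\<close>
    have "closure (dom1 (L z)) \<times> closure (dom2 (L z)) = UNIV"
      using L_dense[OF that] by (simp add: densely_defined_def matrix_op_def closure_Times)
    then show "closure (dom1 (L z)) = UNIV" "closure (dom2 (L z)) = UNIV" by auto
  qed
  have off: "cinner (opapp (C z) f) g = s * cnj (cinner (opapp (B z) g) f)"
    if "C z \<subseteq>\<^sub>o op_scale s (op_adjoint (B z))" "z \<in> \<Omega>" "f \<in> dom1 (L z)" "g \<in> dom2 (L z)" for z f g
    using that B by (intro cinner_op_extends_adjoint) (auto simp: dom1_def dom2_def)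
  have off': "cinner (opapp (B z) g) f = s * cnj (cinner (opapp (C z) f) g)"
    if "C z \<subseteq>\<^sub>o op_scale s (op_adjoint (B z))" "z \<in> \<Omega>" "f \<in> dom1 (L z)" "g \<in> dom2 (L z)" for z f g
    using off[OF that] sign by auto
  have scale1 [simp]: "op_scale 1 T = T" for T :: "('x, 'y::complex_hilbert) operator"
    by (cases T) (simp add: op_scale_def scaleC_one)
  have neg_sign: "- s = 1 \<or> s = 1" using sign by auto
  let ?L' = "\<lambda>z. op_matrix_swap (L z)"
  \<comment> \<open>Here p = 1 and q = - s, so the factor \<open>- (p * q)\<close> of the
    off-diagonal identity is \<open>s\<close>.\<close>
  have i: "fam_ap_spectrum \<Omega> (\<lambda>z. matrix_op (L z))
          \<subseteq> fam_ap_spectrum (fam_resolvent_set \<Omega> D) S1 \<union> pseudo_num_range \<Omega> D \<and>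
        fam_ap_spectrum (fam_resolvent_set \<Omega> D) S1 \<union> pseudo_num_range \<Omega> D
          \<subseteq> pseudo_num_range (fam_resolvent_set \<Omega> D) S1 \<union> pseudo_num_range \<Omega> D \<and>
        ((\<forall>z\<in>fam_spectrum \<Omega> D. is_core (dom2 (L z)) (D z)) \<longrightarrow>
          pseudo_num_range (fam_resolvent_set \<Omega> D) S1 \<union> pseudo_num_range \<Omega> D
            \<subseteq> pseudo_quad_num_range_diag \<Omega> L)"
    if "\<forall>z\<in>fam_resolvent_set \<Omega> D.
          C z \<subseteq>\<^sub>o op_scale s (op_adjoint (B z)) \<and> accretive (A z) \<and>
          sectorial (op_scale (- s) (D z)) \<and> relatively_bounded (B z) (D z)"
      "cdim_gt_1 TYPE('a)" "fam_spectrum \<Omega> D \<subseteq> pseudo_num_range \<Omega> D"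
    using that schur1_spectral_inclusions[of \<Omega> L 1 "- s", OF H2_nonzero]
    by (simp add: lin dense neg_sign off fam_resolvent_set_iff S1)
  \<comment> \<open>For the exchanged matrix \<open>A\<close> is the sectorial corner, so p = - s
    and q = 1; \<open>off'\<close> is the off-diagonal identity solved for \<open>B\<close> by means
    of s^2 = 1.\<close>
  have ii: "fam_ap_spectrum \<Omega> (\<lambda>z. matrix_op (?L' z))
          \<subseteq> fam_ap_spectrum (fam_resolvent_set \<Omega> A) S2 \<union> pseudo_num_range \<Omega> A \<and>
        fam_ap_spectrum (fam_resolvent_set \<Omega> A) S2 \<union> pseudo_num_range \<Omega> A
          \<subseteq> pseudo_num_range (fam_resolvent_set \<Omega> A) S2 \<union> pseudo_num_range \<Omega> A \<and>
        ((\<forall>z\<in>fam_spectrum \<Omega> A. is_core (dom1 (L z)) (A z)) \<longrightarrow>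
          pseudo_num_range (fam_resolvent_set \<Omega> A) S2 \<union> pseudo_num_range \<Omega> A
            \<subseteq> pseudo_quad_num_range_diag \<Omega> ?L')"
    if "\<forall>z\<in>fam_resolvent_set \<Omega> A.
          C z \<subseteq>\<^sub>o op_scale s (op_adjoint (B z)) \<and> sectorial (A z) \<and>
          accretive (op_scale (- s) (D z)) \<and> relatively_bounded (C z) (A z)"
      "cdim_gt_1 TYPE('b)" "fam_spectrum \<Omega> A \<subseteq> pseudo_num_range \<Omega> A"
    using that schur1_spectral_inclusions[of \<Omega> ?L' "- s" 1, OF H1_nonzero]
    by (simp add: lin dense neg_sign off' fam_resolvent_set_iff S2 schur1_op_matrix_swap)
  note diag = pseudo_quad_num_range_diag_subset[of \<Omega> L]
  note swap = fam_ap_spectrum_op_matrix_swap[of \<Omega> L] pseudo_quad_num_range_diag_op_matrix_swap[of \<Omega> L]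
  show ?thesis
  proof (rule conjI; intro impI; elim conjE)
    assume *: "\<forall>z\<in>fam_resolvent_set \<Omega> D.
          C z \<subseteq>\<^sub>o op_scale s (op_adjoint (B z)) \<and> accretive (A z) \<and>
          sectorial (op_scale (- s) (D z)) \<and> relatively_bounded (B z) (D z)"
      "cdim_gt_1 TYPE('a)" "fam_spectrum \<Omega> D \<subseteq> pseudo_num_range \<Omega> D"
    from i[OF *] diag show "fam_ap_spectrum \<Omega> (\<lambda>z. matrix_op (L z))
          \<subseteq> fam_ap_spectrum (fam_resolvent_set \<Omega> D) S1 \<union> pseudo_num_range \<Omega> D \<and>
        fam_ap_spectrum (fam_resolvent_set \<Omega> D) S1 \<union> pseudo_num_range \<Omega> D
          \<subseteq> pseudo_num_range (fam_resolvent_set \<Omega> D) S1 \<union> pseudo_num_range \<Omega> D \<and>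
        ((\<forall>z\<in>fam_spectrum \<Omega> D. is_core (dom2 (L z)) (D z)) \<longrightarrow>
          pseudo_num_range (fam_resolvent_set \<Omega> D) S1 \<union> pseudo_num_range \<Omega> D
            \<subseteq> pseudo_quad_num_range_diag \<Omega> L) \<and>
        pseudo_quad_num_range_diag \<Omega> L \<subseteq> pseudo_quad_num_range \<Omega> L" by (elim conjE) (intro conjI; assumption)
  next
    assume *: "\<forall>z\<in>fam_resolvent_set \<Omega> A.
          C z \<subseteq>\<^sub>o op_scale s (op_adjoint (B z)) \<and> sectorial (A z) \<and>
          accretive (op_scale (- s) (D z)) \<and> relatively_bounded (C z) (A z)"
      "cdim_gt_1 TYPE('b)" "fam_spectrum \<Omega> A \<subseteq> pseudo_num_range \<Omega> A"
    note ii' = ii[OF *]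
    \<comment> \<open>Only the first and third inclusions mention the matrix in \<open>ii'\<close>;
      composing them with \<open>swap\<close> returns to \<open>L\<close>.\<close>
    show "fam_ap_spectrum \<Omega> (\<lambda>z. matrix_op (L z))
          \<subseteq> fam_ap_spectrum (fam_resolvent_set \<Omega> A) S2 \<union> pseudo_num_range \<Omega> A \<and>
        fam_ap_spectrum (fam_resolvent_set \<Omega> A) S2 \<union> pseudo_num_range \<Omega> A
          \<subseteq> pseudo_num_range (fam_resolvent_set \<Omega> A) S2 \<union> pseudo_num_range \<Omega> A \<and>
        ((\<forall>z\<in>fam_spectrum \<Omega> A. is_core (dom1 (L z)) (A z)) \<longrightarrow>
          pseudo_num_range (fam_resolvent_set \<Omega> A) S2 \<union> pseudo_num_range \<Omega> A
            \<subseteq> pseudo_quad_num_range_diag \<Omega> L) \<and>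
        pseudo_quad_num_range_diag \<Omega> L \<subseteq> pseudo_quad_num_range \<Omega> L"
      using order_trans[OF swap(1) conjunct1[OF ii']] conjunct1[OF conjunct2[OF ii']]
        order_trans[OF mp[OF conjunct2[OF conjunct2[OF ii']]] swap(2)] diag
      by (intro conjI impI; assumption?)
  qed
qed

end
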